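(* Let $1\le h\le n-1$, let $\mathcal T$ be a closed target and $x_o\in\mathcal T$. Assume that the target is described near $x_o$ (in $B_R(x_o)$) in one of the following two ways: (Case I, $x_o\in\mathcal T\setminus\partial\mathcal T$) $\mathcal T=\{x:u(x)=u(x_o)\}$, or (Case II, $x_o\in\partial\mathcal T$) $\mathcal T=\{x:u(x)=u(x_o),\ u_{h+1}(x)\ge u_{h+1}(x_o)\}$, where $u={}^t(u_1,\dots,u_h):\mathbb R^n\to\mathbb R^h$ and, in Case II, $u_{h+1}:\mathbb R^n\to\mathbb R$ are at least $C^1$ and the gradients at $x_o$ of all the functions $u_1,\dots,u_h$ (and $u_{h+1}$ in Case II) are linearly independent. In Case II put $\hat u=(u,u_{h+1})$. Suppose that conditions (B1) and (B2), given in the context, are satisfied at $x_o$. In addition suppose that the vector fields satisfying (B1) also satisfy $$(H_{f_1^{(i)}}\boxplus\dots\boxplus H_{f_{j(i)}^{(i)}})^rI(x_o)=0\quad\text{for all } i=1,\dots,m \text{ and } 1\le r<k_i.$$ Then the target is STLA at $x_o$ and there are $C>0$ and $\delta'>0$ such that the minimum time function satisfies $$T(x)\le C|x-x_o|^{1/\bar k},\quad x\in B_{\delta'}(x_o).\qquad( * )$$ If moreover $( * )$ holds near all points $\hat x\in B_{\delta'}(x_o)\cap\mathcal T$ (that is, $T(x)\le C|x-\hat x|^{1/\bar k}$ for $x\in B_{\delta'}(\hat x)$) with $C,\delta',\bar k$ independent of $\hat x$, then $( * )$ improves to $$T(x)\le C\,d(x,\mathcal T)^{1/\bar k}$$ for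 $x$ in a neighborhood of $x_o$. If in particular the assumptions (including this uniformity) hold at all $x_o\in\mathcal T$, then $T$ is locally $1/\bar k$-H\"older continuous in its domain $\{T<+\infty\}$, provided there is $L>0$ with $|F(x,a)-F(y,a)|\le L|x-y|$ for all $x,y\in\mathbb R^n$, $a\in A$.
   Context: Control system: $\dot x_t=F(x_t,a_t)$, $x_0=x\in\mathbb R^n$, where $A$ is a compact subset of a metric space, $F:\mathbb R^n\times A\to\mathbb R^n$ is continuous, and there are $R,L>0$ with $|F(x,a)-F(y,a)|\le L|x-y|$ for all $x,y\in B_R(x_o)$, $a\in A$. Here $B_r(x_o)=\{x:|x-x_o|\le r\}$. It is a standing assumption that the system guarantees existence, uniqueness and uniform boundedness of trajectories. A vector field $f:\mathbb R^n\to\mathbb R^n$ is available if there is $a\in A$ with $f(x)=F(x,a)$ for all $x$. The minimum time function is $T(x)=\inf_{a_\cdot\in L^\infty((0,+\infty);A)}t_x(a)\in[0,+\infty]$, where $t_x(a)=\min\{t\ge0:x_t\in\mathcal T\}\ (\le+\infty)$ and $x_t$ is the trajectory with control $a_\cdot$ and initial point $x$. The target is STLA (small time locally attainable) at $x_o$ if $T$ is continuous at $x_o$ (note $T(x_o)=0$). $d(x,\mathcal T)=\min\{|x-y|:y\in\mathcal T\}$. $\partial\mathcal T$ denotes the boundary of $\mathcal T$ as a manifold with boundary (not the topological boundary). For a vector field $f$ and a scalar function $v$, sufficiently smooth, put $H_f^{(0)}v=v$, $H_fv=f\cdot\nabla v$, $H_f^{(j+1)}v=H_f(H_f^{(j)}v)$.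 For vector fields $f_1,\dots,f_m$ and integer $r\ge0$, $$(H_{f_1}\boxplus\dots\boxplus H_{f_m})^r v=\sum_{i_1+\dots+i_m=r}\frac{r!}{i_1!\cdots i_m!}\,H_{f_1}^{(i_1)}\circ\dots\circ H_{f_m}^{(i_m)}v .$$ For vector valued functions these operators act componentwise. $I(x)=x$ is the identity function on $\mathbb R^n$. A family $a_1,\dots,a_m\in\mathbb R^h$ is a positive basis of $\mathbb R^h$ if every $x\in\mathbb R^h$ can be written $x=\sum_{i=1}^m\lambda_ia_i$ with all $\lambda_i\ge0$. For a vector $\lambda$, $\lambda\ge0$ means that all its components are nonnegative. Condition (B1): there are $m$ groups of available vector fields $f^{(i)}_1,\dots,f^{(i)}_{j(i)}$, $i=1,\dots,m$, and integers $k_i>0$ with $f^{(i)}_r\in C^{k_i-1}(\mathbb R^n;\mathbb R^n)$ and $j(i)=1$ if $k_i=1$; with $\bar k=\max_ik_i$, $u\in C^{\bar k}(\mathbb R^n;\mathbb R^h)$ in Case I (resp. $\hat u\in C^{\bar k}(\mathbb R^n;\mathbb R^{h+1})$ in Case II); moreover, for all $i=1,\dots,m$, $$(H_{f^{(i)}_1}\boxplus\dots\boxplus H_{f^{(i)}_{j(i)}})^ru_l(x_o)=0,\quad 1\le r<k_i,\ l=1,\dots,h\ (\text{resp. } l=1,\dots,h+1),$$ and, in Case I, $A^o_i:=\frac1{k_i!}(H_{f^{(i)}_1}\boxplus\dots\boxplus H_{f^{(i)}_{j(i)}})^{k_i}u(x_o)\ne0$ in $\mathbb R^h$; resp., in Case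 II, ${}^t(A^o_i,s_i):=\frac1{k_i!}(H_{f^{(i)}_1}\boxplus\dots\boxplus H_{f^{(i)}_{j(i)}})^{k_i}\hat u(x_o)\neq0$ in $\mathbb R^{h+1}$, with $A^o_i\in\mathbb R^h$, $s_i\in\mathbb R$. Condition (B2): let $A_o$ be the $h\times m$ matrix with columns $A^o_i$. In Case I, the $m$ columns of $A_o$ form a positive basis of $\mathbb R^h$. In Case II, with $s=(s_1,\dots,s_m)$, the matrix $\hat A_o=\begin{pmatrix}A_o\\ s\end{pmatrix}$ has rank $h+1$ and for all $p\in\mathbb R^h$ and $r\ge0$ there exists $\lambda={}^t(\lambda_1,\dots,\lambda_m)\ge0$ such that $p=A_o\lambda$ and $r\le s\cdot\lambda$. *)

theory Defs
  imports "HOL-Analysis.Analysis"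
begin

subsection \<open>Control system, trajectories and minimum time\<close>

text \<open>Elements of \<open>L\<^sup>\<infinity>((0,\<infinity>);A)\<close>. Boundedness is automatic because \<open>A\<close> will be compact.\<close>

definition controls :: "'c::metric_space set \<Rightarrow> (real \<Rightarrow> 'c) set" where
  "controls A = {\<alpha> \<in> borel_measurable (lebesgue_on {0<..}). \<forall>t>0. \<alpha> t \<in> A}"

text \<open>Caratheodory solutions of \<open>y' = F(y, \<alpha>)\<close>, \<open>y(0) = x\<close> on \<open>[0,\<infinity>)\<close>, in integral form;
  the values of \<open>y\<close> at negative times are irrelevant.\<close>

definition trajectory ::
  "('a::euclidean_space \<Rightarrow> 'c \<Rightarrow> 'a) \<Rightarrow> 'a \<Rightarrow> (real \<Rightarrow> 'c) \<Rightarrow> (real \<Rightarrow> 'a) \<Rightarrow> bool" where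
  "trajectory F x \<alpha> y \<longleftrightarrow> continuous_on {0..} y \<and>
     (\<forall>t\<ge>0. (\<lambda>s. F (y s) (\<alpha> s)) absolutely_integrable_on {0..t} \<and>
            y t = x + integral {0..t} (\<lambda>s. F (y s) (\<alpha> s)))"

text \<open>The last three conjuncts are existence, uniqueness and uniform boundedness of trajectories,
  the latter uniformly in the control, over bounded sets of initial points and bounded times.\<close>

definition control_system ::
  "'c::metric_space set \<Rightarrow> ('a::euclidean_space \<Rightarrow> 'c \<Rightarrow> 'a) \<Rightarrow> bool" where
  "control_system A F \<longleftrightarrow>
     compact A \<and> continuous_on (UNIV \<times> A) (\<lambda>(x, a). F x a) \<and>
     (\<forall>x. \<forall>\<alpha>\<in>controls A. \<exists>y. trajectory F x \<alpha> y) \<and>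
     (\<forall>x. \<forall>\<alpha>\<in>controls A. \<forall>y z. trajectory F x \<alpha> y \<and> trajectory F x \<alpha> z \<longrightarrow> (\<forall>t\<ge>0. y t = z t)) \<and>
     (\<forall>K \<tau>. bounded K \<longrightarrow>
        (\<exists>M. \<forall>x\<in>K. \<forall>\<alpha>\<in>controls A. \<forall>y. trajectory F x \<alpha> y \<longrightarrow> (\<forall>t\<in>{0..\<tau>}. norm (y t) \<le> M)))"

definition lipschitz_in_state_on ::
  "'a::euclidean_space set \<Rightarrow> 'c set \<Rightarrow> ('a \<Rightarrow> 'c \<Rightarrow> 'a) \<Rightarrow> real \<Rightarrow> bool" where
  "lipschitz_in_state_on X A F L \<longleftrightarrow>
     (\<forall>a\<in>A. \<forall>x\<in>X. \<forall>y\<in>X. norm (F x a - F y a) \<le> L * norm (x - y))"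

definition available ::
  "'c set \<Rightarrow> ('a::euclidean_space \<Rightarrow> 'c \<Rightarrow> 'a) \<Rightarrow> ('a \<Rightarrow> 'a) \<Rightarrow> bool" where
  "available A F f \<longleftrightarrow> (\<exists>a\<in>A. \<forall>x. f x = F x a)"

text \<open>The infimum is attained for closed targets, and is \<open>\<infinity>\<close> if the target is never reached.\<close>

definition hitting_time :: "'a set \<Rightarrow> (real \<Rightarrow> 'a) \<Rightarrow> ereal" where
  "hitting_time \<T> y = (INF t\<in>{t. 0 \<le> t \<and> y t \<in> \<T>}. ereal t)"

definition min_time ::
  "'c::metric_space set \<Rightarrow> ('a::euclidean_space \<Rightarrow> 'c \<Rightarrow> 'a) \<Rightarrow> 'a set \<Rightarrow> 'a \<Rightarrow> ereal" where
  "min_time A F \<T> x =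
     (INF (\<alpha>, y)\<in>{(\<alpha>, y). \<alpha> \<in> controls A \<and> trajectory F x \<alpha> y}. hitting_time \<T> y)"

definition STLA ::
  "'c::metric_space set \<Rightarrow> ('a::euclidean_space \<Rightarrow> 'c \<Rightarrow> 'a) \<Rightarrow> 'a set \<Rightarrow> 'a \<Rightarrow> bool" where
  "STLA A F \<T> xo \<longleftrightarrow> isCont (min_time A F \<T>) xo"

definition min_time_holder_at ::
  "'c::metric_space set \<Rightarrow> ('a::euclidean_space \<Rightarrow> 'c \<Rightarrow> 'a) \<Rightarrow> 'a set \<Rightarrow> nat \<Rightarrow> real \<Rightarrow> real \<Rightarrow> 'a \<Rightarrow> bool"
  where
  "min_time_holder_at A F \<T> \<kappa> C \<delta> xo \<longleftrightarrow>
     (\<forall>x\<in>cball xo \<delta>. min_time A F \<T> x \<le> ereal (C * norm (x - xo) powr (1 / real \<kappa>)))"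

text \<open>The estimate with the same constants at all points of the target near \<open>xo\<close>.\<close>

definition min_time_holder_near ::
  "'c::metric_space set \<Rightarrow> ('a::euclidean_space \<Rightarrow> 'c \<Rightarrow> 'a) \<Rightarrow> 'a set \<Rightarrow> nat \<Rightarrow> real \<Rightarrow> real \<Rightarrow> 'a \<Rightarrow> bool"
  where
  "min_time_holder_near A F \<T> \<kappa> C \<delta> xo \<longleftrightarrow>
     (\<forall>z\<in>cball xo \<delta> \<inter> \<T>. min_time_holder_at A F \<T> \<kappa> C \<delta> z)"

definition locally_holder_on :: "real \<Rightarrow> 'a::metric_space set \<Rightarrow> ('a \<Rightarrow> real) \<Rightarrow> bool" where
  "locally_holder_on \<gamma> D g \<longleftrightarrow>
     (\<forall>z\<in>D. \<exists>\<epsilon>>0. \<exists>C. \<forall>x\<in>cball z \<epsilon> \<inter> D. \<forall>y\<in>cball z \<epsilon> \<inter> D. dist (g x) (g y) \<le> C * dist x y powr \<gamma>)"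

subsection \<open>Smooth functions and the operators \<open>H\<close>\<close>

fun C_k :: "nat \<Rightarrow> ('a::euclidean_space \<Rightarrow> 'b::real_normed_vector) \<Rightarrow> bool" where
  "C_k 0 v \<longleftrightarrow> continuous_on UNIV v"
| "C_k (Suc k) v \<longleftrightarrow>
     (\<forall>x. v differentiable at x) \<and> (\<forall>b\<in>Basis. C_k k (\<lambda>x. frechet_derivative v (at x) b))"

definition gradient :: "('a::euclidean_space \<Rightarrow> real) \<Rightarrow> 'a \<Rightarrow> 'a" where
  "gradient v x = (THE D. GDERIV v x :> D)"

text \<open>\<open>H\<^sub>f v = f \<cdot> \<nabla>v\<close> is the derivative of \<open>v\<close> in direction \<open>f\<close>; this form covers vector valued \<open>v\<close>,
  on which the operator acts componentwise (see the two lemmas).\<close>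

definition lie_deriv ::
  "('a::euclidean_space \<Rightarrow> 'a) \<Rightarrow> ('a \<Rightarrow> 'b::real_normed_vector) \<Rightarrow> 'a \<Rightarrow> 'b" where
  "lie_deriv f v = (\<lambda>x. frechet_derivative v (at x) (f x))"

lemma lie_deriv_gradient:
  fixes v :: "'a::euclidean_space \<Rightarrow> real"
  assumes "v differentiable at x"
  shows "lie_deriv f v x = f x \<bullet> gradient v x"
proof -
  let ?D = "frechet_derivative v (at x)"
  have d: "(v has_derivative ?D) (at x)"
    using assms frechet_derivative_works by blast
  then have l: "linear ?D"
    by (rule has_derivative_linear)
  define g where "g = (\<Sum>b\<in>Basis. ?D b *\<^sub>R b)"
  have D: "?D h = h \<bullet> g" for h
  proof -
    have "?D h = ?D (\<Sum>b\<in>Basis. (h \<bullet> b) *\<^sub>R b)"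
      by (simp add: euclidean_representation)
    also have "\<dots> = h \<bullet> g"
      unfolding g_def using l
      by (simp add: linear_sum linear_scale inner_sum_right o_def mult.commute)
    finally show ?thesis .
  qed
  have "gradient v x = g"
    unfolding gradient_def
  proof (rule the_equality)
    show "GDERIV v x :> g"
      unfolding gderiv_def using d by (simp add: D[abs_def])
  next
    fix E assume "GDERIV v x :> E"
    then have "(\<lambda>h. h \<bullet> E) = ?D"
      unfolding gderiv_def by (rule frechet_derivative_at)
    then have "\<forall>h. h \<bullet> E = h \<bullet> g"
      using D by metis
    then show "E = g"
      using vector_eq_ldot by blast
  qed
  then show ?thesis
    by (simp add: lie_deriv_def D)
qed

lemma lie_deriv_component:
  fixes v :: "'a::euclidean_space \<Rightarrow> 'b::euclidean_space"
  assumes "v differentiable at x"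
  shows "lie_deriv f v x \<bullet> b = lie_deriv f (\<lambda>y. v y \<bullet> b) x"
proof -
  have "(v has_derivative frechet_derivative v (at x)) (at x)"
    using assms frechet_derivative_works by blast
  then have "((\<lambda>y. v y \<bullet> b) has_derivative (\<lambda>h. frechet_derivative v (at x) h \<bullet> b)) (at x)"
    by (rule has_derivative_inner_left)
  then have "(\<lambda>h. frechet_derivative v (at x) h \<bullet> b) = frechet_derivative (\<lambda>y. v y \<bullet> b) (at x)"
    by (rule frechet_derivative_at)
  then show ?thesis
    unfolding lie_deriv_def by metis
qed

text \<open>\<open>(H\<^sub>f\<^sub>1 \<boxplus> \<dots> \<boxplus> H\<^sub>f\<^sub>m)\<^sup>r v\<close> for the list \<open>fs = [f\<^sub>1, \<dots>, f\<^sub>m]\<close>; a multi-index is a list \<open>is\<close> of the same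
  length, and the head of \<open>fs\<close> is the outermost operator of the composition.\<close>

definition lie_boxplus ::
  "('a::euclidean_space \<Rightarrow> 'a) list \<Rightarrow> nat \<Rightarrow> ('a \<Rightarrow> 'b::real_normed_vector) \<Rightarrow> 'a \<Rightarrow> 'b" where
  "lie_boxplus fs r v = (\<lambda>x.
     \<Sum>is\<in>{is. length is = length fs \<and> sum_list is = r}.
       (fact r / prod_list (map fact is)) *\<^sub>R foldr (\<lambda>(f, i) w. (lie_deriv f ^^ i) w) (zip fs is) v x)"

lemma finite_multi_indices: "finite {is :: nat list. length is = n \<and> sum_list is = r}"
proof (rule finite_subset)
  show "{is :: nat list. length is = n \<and> sum_list is = r} \<subseteq> {is. set is \<subseteq> {..r} \<and> length is = n}"
    by (auto simp: member_le_sum_list)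
  show "finite {is :: nat list. set is \<subseteq> {..r} \<and> length is = n}"
    by (rule finite_lists_length_eq) simp
qed

subsection \<open>Description of the target\<close>

text \<open>The boundary of \<open>M\<close> as a manifold with boundary: the points which some chart, with values in
  a half space of a linear subspace \<open>S\<close>, sends to the bounding hyperplane.\<close>

definition manifold_boundary :: "'a::euclidean_space set \<Rightarrow> 'a set" where
  "manifold_boundary M = {x \<in> M. \<exists>V (S :: 'a set) a W \<phi> \<psi>.
     openin (top_of_set M) V \<and> x \<in> V \<and> subspace S \<and> a \<in> S \<and> a \<noteq> 0 \<and>
     openin (top_of_set {y \<in> S. 0 \<le> a \<bullet> y}) W \<and> homeomorphism V W \<phi> \<psi> \<and> a \<bullet> \<phi> x = 0}"

definition independent_family :: "('i \<Rightarrow> 'v::real_vector) \<Rightarrow> bool" where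
  "independent_family g \<longleftrightarrow> inj g \<and> independent (range g)"

definition target_I ::
  "(real^'n) set \<Rightarrow> real^'n \<Rightarrow> real \<Rightarrow> (real^'n \<Rightarrow> real^'h) \<Rightarrow> bool" where
  "target_I \<T> xo R u \<longleftrightarrow>
     xo \<in> \<T> - manifold_boundary \<T> \<and>
     \<T> \<inter> cball xo R = {x \<in> cball xo R. u x = u xo} \<and>
     C_k 1 u \<and>
     independent_family (\<lambda>l. gradient (\<lambda>x. u x $ l) xo)"

text \<open>\<open>w\<close> is the component \<open>u\<^sub>h\<^sub>+\<^sub>1\<close>; the index \<open>None\<close> stands for \<open>h+1\<close>.\<close>

definition target_II ::
  "(real^'n) set \<Rightarrow> real^'n \<Rightarrow> real \<Rightarrow> (real^'n \<Rightarrow> real^'h) \<Rightarrow> (real^'n \<Rightarrow> real) \<Rightarrow> bool" where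
  "target_II \<T> xo R u w \<longleftrightarrow>
     xo \<in> manifold_boundary \<T> \<and>
     \<T> \<inter> cball xo R = {x \<in> cball xo R. u x = u xo \<and> w x \<ge> w xo} \<and>
     C_k 1 u \<and> C_k 1 w \<and>
     independent_family (\<lambda>l. case l of None \<Rightarrow> gradient w xo | Some l \<Rightarrow> gradient (\<lambda>x. u x $ l) xo)"

subsection \<open>Conditions on the vector fields\<close>

text \<open>The groups of vector fields are the lists \<open>fs i\<close>, \<open>i = 1, \<dots>, m\<close>, with orders \<open>k i\<close>.
  The function \<open>v\<close> is \<open>u\<close> if \<open>xo\<close> is off the manifold boundary, and \<open>\<lambda>x. (u x, u\<^sub>h\<^sub>+\<^sub>1 x)\<close> if it is on it;
  \<open>\<real>\<^sup>h\<^sup>+\<^sup>1\<close> is represented by \<open>\<real>\<^sup>h \<times> \<real>\<close>.\<close>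

definition max_order :: "nat \<Rightarrow> (nat \<Rightarrow> nat) \<Rightarrow> nat" where
  "max_order m k = Max (k ` {1..m})"

definition leading_coeff ::
  "(nat \<Rightarrow> ('a::euclidean_space \<Rightarrow> 'a) list) \<Rightarrow> (nat \<Rightarrow> nat) \<Rightarrow> ('a \<Rightarrow> 'b::euclidean_space) \<Rightarrow> 'a \<Rightarrow> nat \<Rightarrow> 'b"
  where
  "leading_coeff fs k v xo i = (1 / fact (k i)) *\<^sub>R lie_boxplus (fs i) (k i) v xo"

definition cond_B1 ::
  "'c set \<Rightarrow> ('a::euclidean_space \<Rightarrow> 'c \<Rightarrow> 'a) \<Rightarrow> nat \<Rightarrow> (nat \<Rightarrow> ('a \<Rightarrow> 'a) list) \<Rightarrow> (nat \<Rightarrow> nat)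
     \<Rightarrow> ('a \<Rightarrow> 'b::euclidean_space) \<Rightarrow> 'a \<Rightarrow> bool" where
  "cond_B1 A F m fs k v xo \<longleftrightarrow>
     m > 0 \<and>
     (\<forall>i\<in>{1..m}. k i > 0 \<and> fs i \<noteq> [] \<and>
        (\<forall>f\<in>set (fs i). available A F f \<and> C_k (k i - 1) f) \<and>
        (k i = 1 \<longrightarrow> length (fs i) = 1)) \<and>
     C_k (max_order m k) v \<and>
     (\<forall>i\<in>{1..m}. (\<forall>r. 1 \<le> r \<and> r < k i \<longrightarrow> lie_boxplus (fs i) r v xo = 0) \<and>
        leading_coeff fs k v xo i \<noteq> 0)"

definition positive_basis :: "nat \<Rightarrow> (nat \<Rightarrow> 'b::real_vector) \<Rightarrow> bool" where
  "positive_basis m a \<longleftrightarrow>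
     (\<forall>x. \<exists>\<mu>::nat \<Rightarrow> real. (\<forall>i\<in>{1..m}. \<mu> i \<ge> 0) \<and> x = (\<Sum>i\<in>{1..m}. \<mu> i *\<^sub>R a i))"

text \<open>For points on the manifold boundary: the columns of \<open>\<hat>A\<^sub>o\<close> are \<open>a i = (A\<^sub>o\<^sub>,\<^sub>i, s\<^sub>i)\<close>, and its rank is the dimension of
  their span.\<close>

definition cond_B2_II :: "nat \<Rightarrow> (nat \<Rightarrow> (real^'h) \<times> real) \<Rightarrow> bool" where
  "cond_B2_II m a \<longleftrightarrow>
     dim (span (a ` {1..m})) = CARD('h) + 1 \<and>
     (\<forall>p r. r \<ge> 0 \<longrightarrow> (\<exists>\<mu>::nat \<Rightarrow> real. (\<forall>i\<in>{1..m}. \<mu> i \<ge> 0) \<and>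
        p = (\<Sum>i\<in>{1..m}. \<mu> i *\<^sub>R fst (a i)) \<and> r \<le> (\<Sum>i\<in>{1..m}. snd (a i) * \<mu> i)))"

definition cond_identity ::
  "nat \<Rightarrow> (nat \<Rightarrow> ('a::euclidean_space \<Rightarrow> 'a) list) \<Rightarrow> (nat \<Rightarrow> nat) \<Rightarrow> 'a \<Rightarrow> bool" where
  "cond_identity m fs k xo \<longleftrightarrow>
     (\<forall>i\<in>{1..m}. \<forall>r. 1 \<le> r \<and> r < k i \<longrightarrow> lie_boxplus (fs i) r (\<lambda>x. x) xo = 0)"

text \<open>The argument \<open>w\<close> is not used in the first alternative (\<open>xo\<close> off the manifold boundary).\<close>

definition attainability_hyps ::
  "'c::metric_space set \<Rightarrow> (real^'n \<Rightarrow> 'c \<Rightarrow> real^'n) \<Rightarrow> (real^'n) set \<Rightarrow> real^'n \<Rightarrow> real \<Rightarrow> real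
     \<Rightarrow> (real^'n \<Rightarrow> real^'h) \<Rightarrow> (real^'n \<Rightarrow> real)
     \<Rightarrow> nat \<Rightarrow> (nat \<Rightarrow> (real^'n \<Rightarrow> real^'n) list) \<Rightarrow> (nat \<Rightarrow> nat) \<Rightarrow> bool" where
  "attainability_hyps A F \<T> xo R L u w m fs k \<longleftrightarrow>
     R > 0 \<and> L > 0 \<and> lipschitz_in_state_on (cball xo R) A F L \<and>
     (target_I \<T> xo R u \<and> cond_B1 A F m fs k u xo \<and>
        positive_basis m (leading_coeff fs k u xo)
      \<or>
      target_II \<T> xo R u w \<and> cond_B1 A F m fs k (\<lambda>x. (u x, w x)) xo \<and>
        cond_B2_II m (leading_coeff fs k (\<lambda>x. (u x, w x)) xo)) \<and>
     cond_identity m fs k xo"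

end

theory Submission
  imports Defs
begin

text \<open>Fix a group \<open>f\<^sub>1, \<dots>, f\<^sub>j\<close> of order \<open>\<kappa>\<close> and follow each field for the time \<open>t\<close>, \<open>f\<^sub>1\<close> first.
  The Taylor coefficients in \<open>t\<close> of a function \<open>v\<close> along this motion are
  \<open>(H\<^sub>1 \<boxplus> \<dots> \<boxplus> H\<^sub>j)\<^sup>r v / r!\<close>.  Those with \<open>1 \<le> r < \<kappa>\<close> vanish at \<open>xo\<close>, hence they are of size
  \<open>|x - xo|\<close> at a nearby point \<open>x\<close>, and the motion changes \<open>v\<close> by
  \<open>t\<^sup>\<kappa> a + o(t\<^sup>\<kappa> + |x - xo|)\<close>, where \<open>a\<close> is the leading coefficient (\<open>multi_flow_expansion\<close>).
  The condition on the identity function says, in the same way, that the point itself moves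
  only by \<open>O(t\<^sup>\<kappa> + |x - xo|)\<close>.

  Let \<open>|x - xo| \<le> \<epsilon>\<close> and run the groups one after the other, group \<open>i\<close> with \<open>t = (\<epsilon> \<lambda>\<^sub>i)\<^bsup>1/k\<^sub>i\<^esup>\<close>.
  All intermediate points stay within \<open>O(\<epsilon>)\<close> of \<open>xo\<close>, so the errors add up and \<open>v\<close> changes by
  \<open>\<epsilon> (\<Sum>\<^sub>i \<lambda>\<^sub>i a\<^sub>i) + o(\<epsilon>)\<close>, uniformly for bounded \<open>\<lambda> \<ge> 0\<close> (\<open>steer_expansion\<close>).  The columns \<open>a\<^sub>i\<close>
  span positively, so \<open>\<lambda>\<close> can be chosen as an affine function of a prescribed increment
  \<open>p = \<Sum>\<^sub>i \<lambda>\<^sub>i a\<^sub>i\<close>, with \<open>\<lambda> \<ge> 0\<close> for all \<open>p\<close> in a given ball.  The end point depends continuously on \<open>p\<close>,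
  and Brouwer's fixed point theorem finds a \<open>p\<close> for which the error is compensated exactly
  (\<open>steer_onto\<close>).  On the manifold boundary only the equations \<open>u = u(xo)\<close> are solved in this way; the
  inequality for \<open>u\<^sub>h\<^sub>+\<^sub>1\<close> is obtained by adding to \<open>\<lambda>\<close> a large multiple of a vector that does not
  change \<open>u\<close> to first order but increases \<open>u\<^sub>h\<^sub>+\<^sub>1\<close>.  The elapsed time is a sum of terms
  \<open>O(\<epsilon>\<^bsup>1/k\<^sub>i\<^esup>)\<close>, which is the Hoelder estimate at \<open>xo\<close>; continuity of the minimum time at \<open>xo\<close> follows.

  The estimate by the distance to the target is the one at a nearest target point.  For the local
  Hoelder continuity, a nearly optimal control for \<open>y\<close> is applied from a nearby \<open>x\<close>: by the global Lipschitz
  condition it ends at distance \<open>O(|x - y|)\<close> from a target point, from where the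
  remaining time is \<open>O(|x - y|\<^bsup>1/\<kappa>\<^esup>)\<close> (\<open>min_time_locally_holder\<close>).\<close>

section \<open>Iterated Lie derivatives of functions of class C^k\<close>

lemma C_k_Suc_imp: "C_k (Suc k) v \<Longrightarrow> C_k k v"
proof (induction k arbitrary: v)
  case 0
  then show ?case
    by (auto intro!: continuous_at_imp_continuous_on differentiable_imp_continuous_within)
next
  case (Suc k)
  then show ?case by (metis C_k.simps(2))
qed

lemma C_k_le: "C_k k v \<Longrightarrow> j \<le> k \<Longrightarrow> C_k j v"
  by (induction k) (auto simp del: C_k.simps simp: le_Suc_eq dest: C_k_Suc_imp)

lemma C_k_differentiable: "C_k k v \<Longrightarrow> k > 0 \<Longrightarrow> v differentiable at x"
  by (cases k) auto

lemma C_k_continuous: "C_k k v \<Longrightarrow> continuous_on UNIV v"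
  using C_k_le[of k v 0] by simp

lemma C_k_SucI:
  assumes "\<And>x. (v has_derivative D x) (at x)" "\<And>b. b \<in> Basis \<Longrightarrow> C_k k (\<lambda>x. D x b)"
  shows "C_k (Suc k) v"
proof -
  have "frechet_derivative v (at x) = D x" for x
    using frechet_derivative_at[OF assms(1)] by simp
  then show ?thesis
    using assms by (auto simp: differentiable_def)
qed

lemma C_k_has_derivative:
  "C_k (Suc k) v \<Longrightarrow> (v has_derivative frechet_derivative v (at x)) (at x)"
  using frechet_derivative_works by auto

lemma C_k_const: "C_k k (\<lambda>x. c)"
proof (induction k arbitrary: c)
  case (Suc k)
  then show ?case by (intro C_k_SucI[where D="\<lambda>x h. 0"]) auto
qed simp

lemma C_k_ident: "C_k k (\<lambda>x. x)"
proof (cases k)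
  case (Suc j)
  then show ?thesis
    using C_k_SucI[where D="\<lambda>x h. h" and v="\<lambda>x. x"] C_k_const by auto
qed simp

lemma C_k_add: "C_k k v \<Longrightarrow> C_k k w \<Longrightarrow> C_k k (\<lambda>x. v x + w x)"
proof (induction k arbitrary: v w)
  case (Suc k)
  show ?case
    using Suc by (intro C_k_SucI[OF has_derivative_add[OF C_k_has_derivative C_k_has_derivative]])
      auto
qed (auto intro: continuous_intros)

lemma C_k_bounded_linear:
  assumes "bounded_linear l"
  shows "C_k k v \<Longrightarrow> C_k k (\<lambda>x. l (v x))"
proof (induction k arbitrary: v)
  case (Suc k)
  show ?case
    using Suc by (intro C_k_SucI[OF bounded_linear.has_derivative[OF assms C_k_has_derivative]])
      auto
qed (auto intro: bounded_linear.continuous_on[OF assms])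

lemma C_k_sum: "(\<And>i. i \<in> I \<Longrightarrow> C_k k (v i)) \<Longrightarrow> C_k k (\<lambda>x. \<Sum>i\<in>I. v i x)"
  by (induction I rule: infinite_finite_induct) (auto intro: C_k_add C_k_const)

lemma C_k_scaleR: "C_k k p \<Longrightarrow> C_k k v \<Longrightarrow> C_k k (\<lambda>x. p x *\<^sub>R v x)"
proof (induction k arbitrary: p v)
  case (Suc k)
  have "C_k k p" "C_k k v" using Suc.prems by (auto dest: C_k_Suc_imp simp del: C_k.simps)
  then show ?case
    using Suc by (intro C_k_SucI[OF has_derivative_scaleR[OF C_k_has_derivative C_k_has_derivative]]
      C_k_add) auto
qed (auto intro: continuous_intros)

lemma lie_deriv_sum_Basis:
  assumes "v differentiable at x"
  shows "lie_deriv f v x = (\<Sum>b\<in>Basis. (f x \<bullet> b) *\<^sub>R frechet_derivative v (at x) b)"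
proof -
  have l: "linear (frechet_derivative v (at x))"
    using assms linear_frechet_derivative by blast
  have "lie_deriv f v x = frechet_derivative v (at x) (\<Sum>b\<in>Basis. (f x \<bullet> b) *\<^sub>R b)"
    by (simp add: lie_deriv_def euclidean_representation)
  then show ?thesis
    by (simp add: linear_sum[OF l] linear_scale[OF l])
qed

lemma C_k_lie_deriv:
  assumes "C_k k f" "C_k (Suc k) v"
  shows "C_k k (lie_deriv f v)"
proof -
  have "lie_deriv f v = (\<lambda>x. \<Sum>b\<in>Basis. (f x \<bullet> b) *\<^sub>R frechet_derivative v (at x) b)"
    using assms(2) by (auto simp: lie_deriv_sum_Basis)
  then show ?thesis
    using assms by (auto intro!: C_k_sum C_k_scaleR C_k_bounded_linear[of "\<lambda>y. y \<bullet> _"]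
       bounded_linear_inner_left)
qed

text \<open>For \<open>N\<close> derivatives of \<open>v\<close>, \<open>N - 1\<close> derivatives of \<open>f\<close> suffice: the operator differentiates first and
  then multiplies by \<open>f\<close>, so the first factor \<open>f\<close> meets at most \<open>N - 1\<close> further differentiations.\<close>

lemma C_k_lie_deriv_funpow:
  assumes "C_k (N - 1) f"
  shows "C_k (n + j) v \<Longrightarrow> n + j \<le> N \<Longrightarrow> C_k n ((lie_deriv f ^^ j) v)"
proof (induction j arbitrary: n)
  case (Suc j)
  have "C_k (Suc n) ((lie_deriv f ^^ j) v)"
    using Suc.IH[of "Suc n"] Suc.prems by (simp del: C_k.simps)
  moreover have "C_k n f"
    using C_k_le[OF assms] Suc.prems by auto
  ultimately show ?case
    by (simp add: C_k_lie_deriv del: C_k.simps)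
qed simp

lemma lie_deriv_lincomb:
  assumes "\<And>i x. i \<in> I \<Longrightarrow> v i differentiable at x"
  shows "lie_deriv f (\<lambda>x. \<Sum>i\<in>I. c i *\<^sub>R v i x) = (\<lambda>x. \<Sum>i\<in>I. c i *\<^sub>R lie_deriv f (v i) x)"
proof
  fix x
  have "((\<lambda>x. \<Sum>i\<in>I. c i *\<^sub>R v i x) has_derivative
      (\<lambda>h. \<Sum>i\<in>I. c i *\<^sub>R frechet_derivative (v i) (at x) h)) (at x)"
    using assms frechet_derivative_works
    by (intro has_derivative_sum has_derivative_scaleR_right) blast
  from fun_cong[OF frechet_derivative_at[OF this], of "f x"]
  show "lie_deriv f (\<lambda>x. \<Sum>i\<in>I. c i *\<^sub>R v i x) x = (\<Sum>i\<in>I. c i *\<^sub>R lie_deriv f (v i) x)"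
    by (simp add: lie_deriv_def)
qed

text \<open>Differentiability of the intermediate functions is needed at each step: \<open>frechet_derivative\<close>
  is not linear on arbitrary functions.\<close>

lemma lie_deriv_funpow_lincomb:
  assumes "C_k (N - 1) f"
  shows "(\<And>i. i \<in> I \<Longrightarrow> C_k j (v i)) \<Longrightarrow> j \<le> N \<Longrightarrow>
    (lie_deriv f ^^ j) (\<lambda>x. \<Sum>i\<in>I. c i *\<^sub>R v i x) = (\<lambda>x. \<Sum>i\<in>I. c i *\<^sub>R (lie_deriv f ^^ j) (v i) x)"
proof (induction j)
  case (Suc j)
  have "(lie_deriv f ^^ j) (v i) differentiable at x" if "i \<in> I" for i x
    using C_k_lie_deriv_funpow[OF assms, of 1 j "v i"] Suc.prems that
    by (intro C_k_differentiable[of 1]) (auto simp del: C_k.simps)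
  moreover have "C_k j (v i)" if "i \<in> I" for i
    using Suc.prems(1)[OF that] C_k_Suc_imp by blast
  ultimately show ?case
    using Suc by (simp add: lie_deriv_lincomb del: C_k.simps)
qed simp

text \<open>The monomial \<open>H\<^sub>1\<^bsup>i\<^sub>1\<^esup> \<circ> \<dots> \<circ> H\<^sub>m\<^bsup>i\<^sub>m\<^esup>\<close> of \<open>lie_boxplus\<close>.\<close>

definition lie_word :: "('a::euclidean_space \<Rightarrow> 'a) list \<Rightarrow> nat list \<Rightarrow> ('a \<Rightarrow> 'b::real_normed_vector)
    \<Rightarrow> 'a \<Rightarrow> 'b" where
  "lie_word fs is v = foldr (\<lambda>(f, i) w. (lie_deriv f ^^ i) w) (zip fs is) v"

lemma C_k_lie_word:
  assumes "\<And>f. f \<in> set fs \<Longrightarrow> C_k (N - 1) f" "length is = length fs"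
    "C_k (n + sum_list is) v" "n + sum_list is \<le> N"
  shows "C_k n (lie_word fs is v)"
  using assms(2,1,3,4)
proof (induction "is" fs arbitrary: n rule: list_induct2)
  case (Cons i "is" f fs)
  have "C_k (n + i) (lie_word fs is v)"
    using Cons by (intro Cons.IH) (auto simp: add.assoc)
  then show ?case
    using C_k_lie_deriv_funpow[of N f n i "lie_word fs is v"] Cons.prems
    by (simp add: lie_word_def)
qed (simp add: lie_word_def)

lemma C_k_lie_boxplus:
  assumes "\<And>f. f \<in> set fs \<Longrightarrow> C_k (N - 1) f" "C_k (n + r) v" "n + r \<le> N"
  shows "C_k n (lie_boxplus fs r v)"
  unfolding lie_boxplus_def lie_word_def[symmetric] using assms
  by (intro C_k_sum C_k_scaleR C_k_const C_k_lie_word) auto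

lemma multi_indices_Suc:
  "{is :: nat list. length is = Suc n \<and> sum_list is = r} =
   (\<lambda>(j, is). j # is) ` (SIGMA j:{..r}. {is. length is = n \<and> sum_list is = r - j})"
proof -
  have "is \<in> (\<lambda>(j, is). j # is) ` (SIGMA j:{..r}. {is. length is = n \<and> sum_list is = r - j})"
    if "length is = Suc n" "sum_list is = r" for "is"
    using that by (intro image_eqI[of _ _ "(hd is, tl is)"]; cases "is") auto
  then show ?thesis by auto
qed

text \<open>The binomial theorem for the noncommuting operators, with the first field kept outermost.
  It makes the Taylor expansion along a chain of flows accessible to induction on the list.\<close>

lemma lie_boxplus_Cons:
  assumes "\<And>g. g \<in> set (f # fs) \<Longrightarrow> C_k (N - 1) g" "C_k r v" "r \<le> N"
  shows "lie_boxplus (f # fs) r v x =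
    (\<Sum>j\<le>r. of_nat (r choose j) *\<^sub>R (lie_deriv f ^^ j) (lie_boxplus fs (r - j) v) x)"
proof -
  let ?S = "\<lambda>j. {is. length is = length fs \<and> sum_list is = r - j}"
  have "lie_boxplus (f # fs) r v x = (\<Sum>(j, is)\<in>(SIGMA j:{..r}. ?S j).
      (fact r / (fact j * prod_list (map fact is))) *\<^sub>R (lie_deriv f ^^ j) (lie_word fs is v) x)"
    unfolding lie_boxplus_def list.size(4) add_Suc_right add_0_right multi_indices_Suc
    by (subst sum.reindex) (auto simp: inj_on_def lie_word_def o_def intro!: sum.cong)
  also have "\<dots> = (\<Sum>j\<le>r. \<Sum>is\<in>?S j.
      (fact r / (fact j * prod_list (map fact is))) *\<^sub>R (lie_deriv f ^^ j) (lie_word fs is v) x)"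
    by (rule sum.Sigma[symmetric]) (auto simp: finite_multi_indices)
  also have "\<dots> = (\<Sum>j\<le>r. of_nat (r choose j) *\<^sub>R (lie_deriv f ^^ j) (lie_boxplus fs (r - j) v) x)"
  proof (rule sum.cong)
    fix j assume j: "j \<in> {..r}"
    have "C_k j (lie_word fs is v)" if "is \<in> ?S j" for "is"
      using that assms j by (intro C_k_lie_word[of fs N]) auto
    then have "(lie_deriv f ^^ j) (lie_boxplus fs (r - j) v) x =
       (\<Sum>is\<in>?S j. (fact (r - j) / prod_list (map fact is)) *\<^sub>R (lie_deriv f ^^ j) (lie_word fs is v) x)"
      unfolding lie_boxplus_def lie_word_def[symmetric] using assms j
      by (subst lie_deriv_funpow_lincomb[of N]) auto
    then show "(\<Sum>is\<in>?S j.
      (fact r / (fact j * prod_list (map fact is))) *\<^sub>R (lie_deriv f ^^ j) (lie_word fs is v) x)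
      = of_nat (r choose j) *\<^sub>R (lie_deriv f ^^ j) (lie_boxplus fs (r - j) v) x"
      using j by (simp add: scaleR_sum_right binomial_fact field_simps)
  qed simp
  finally show ?thesis .
qed

lemma lie_boxplus_Nil: "lie_boxplus [] r v x = (if r = 0 then v x else 0)"
proof -
  have "{is :: nat list. length is = length [] \<and> sum_list is = r} = (if r = 0 then {[]} else {})"
    by auto
  then show ?thesis by (simp only: lie_boxplus_def) simp
qed

lemma lie_boxplus_0: "lie_boxplus fs 0 v x = v x"
proof -
  have "{is :: nat list. length is = length fs \<and> sum_list is = 0} = {replicate (length fs) 0}"
    by (auto intro: replicate_eqI)
  moreover have "foldr (\<lambda>(f, i) w. (lie_deriv f ^^ i) w) (zip fs (replicate (length fs) 0)) v = v"
    by (induction fs) auto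
  moreover have "prod_list (map fact (replicate n (0::nat))) = (1::real)" for n
    by (induction n) auto
  ultimately show ?thesis by (simp only: lie_boxplus_def) simp
qed

section \<open>Taylor expansion along a chain of flows\<close>

text \<open>The mean value inequality for the remainder, whose derivative is the remainder of order
  \<open>N\<close> for the shifted sequence.  The bound uses only the oscillation of the last derivative, which is
  all that functions of class \<open>C\<^sup>N\<close> provide.\<close>

lemma taylor_curve:
  fixes c :: "nat \<Rightarrow> real \<Rightarrow> 'b::real_normed_vector"
  assumes "0 \<le> t"
    and "\<And>j s. j < N \<Longrightarrow> s \<in> {0..t} \<Longrightarrow> (c j has_vector_derivative c (Suc j) s) (at s within {0..t})"
    and "\<And>s. s \<in> {0..t} \<Longrightarrow> norm (c N s - c N 0) \<le> e"
  shows "norm (c 0 t - (\<Sum>j\<le>N. (t ^ j / fact j) *\<^sub>R c j 0)) \<le> e * t ^ N"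
  using assms
proof (induction N arbitrary: c t)
  case 0
  then show ?case by simp
next
  case (Suc N)
  define r where "r s = c 0 s - (\<Sum>j\<le>Suc N. (s ^ j / fact j) *\<^sub>R c j 0)" for s
  define r' where "r' s = c 1 s - (\<Sum>j\<le>N. (s ^ j / fact j) *\<^sub>R c (Suc j) 0)" for s
  have e: "0 \<le> e" using Suc.prems(3)[of 0] Suc.prems(1) by simp
  have r': "norm (r' s) \<le> e * t ^ N" if s: "s \<in> {0..t}" for s
  proof -
    have "norm (r' s) \<le> e * s ^ N"
      unfolding r'_def One_nat_def
    proof (rule Suc.IH[of s "\<lambda>j. c (Suc j)"])
      show "(c (Suc j) has_vector_derivative c (Suc (Suc j)) q) (at q within {0..s})"
        if "j < N" "q \<in> {0..s}" for j q
        using Suc.prems(2)[of "Suc j" q] s that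
        by (intro has_vector_derivative_within_subset[where S="{0..t}" and T="{0..s}"]) auto
    qed (use Suc.prems s in auto)
    also have "\<dots> \<le> e * t ^ N"
      using s e by (intro mult_left_mono power_mono) auto
    finally show ?thesis .
  qed
  have dr: "(r has_vector_derivative r' s) (at s within {0..t})" if s: "s \<in> {0..t}" for s
  proof -
    have "((\<lambda>s. (s ^ Suc j / fact (Suc j)) *\<^sub>R c (Suc j) 0) has_vector_derivative
       (s ^ j / fact j) *\<^sub>R c (Suc j) 0) (at s within {0..t})" for j
    proof -
      have "((\<lambda>s. s ^ Suc j / fact (Suc j)) has_field_derivative (s ^ j / fact j)) (at s within {0..t})"
        using DERIV_cdivide[OF DERIV_power[where n="Suc j", OF DERIV_ident], where c="fact (Suc j)"]
        by (simp del: of_nat_Suc)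
      then show ?thesis
        by (rule has_vector_derivative_scaleR[OF _ has_vector_derivative_const, simplified])
    qed
    then have "((\<lambda>s. \<Sum>j\<le>N. (s ^ Suc j / fact (Suc j)) *\<^sub>R c (Suc j) 0) has_vector_derivative
       (\<Sum>j\<le>N. (s ^ j / fact j) *\<^sub>R c (Suc j) 0)) (at s within {0..t})"
      by (intro has_vector_derivative_sum) auto
    moreover have "(c 0 has_vector_derivative c 1 s) (at s within {0..t})"
      using Suc.prems(2)[of 0 s] s by simp
    ultimately have "((\<lambda>s. c 0 s - (c 0 0 + (\<Sum>j\<le>N. (s ^ Suc j / fact (Suc j)) *\<^sub>R c (Suc j) 0)))
        has_vector_derivative c 1 s - (0 + (\<Sum>j\<le>N. (s ^ j / fact j) *\<^sub>R c (Suc j) 0))) (at s within {0..t})"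
      by (intro has_vector_derivative_diff has_vector_derivative_add has_vector_derivative_const)
    moreover have "(\<Sum>j\<le>Suc N. (s ^ j / fact j) *\<^sub>R c j 0) =
       c 0 0 + (\<Sum>j\<le>N. (s ^ Suc j / fact (Suc j)) *\<^sub>R c (Suc j) 0)" for s
      by (subst sum.atMost_Suc_shift) simp
    ultimately show ?thesis
      by (simp add: r_def[abs_def] r'_def)
  qed
  have "norm (r t - r 0) \<le> (e * t ^ N) * norm (t - 0)"
  proof (rule differentiable_bound[where S="{0..t}"])
    show "(r has_derivative (\<lambda>h. h *\<^sub>R r' s)) (at s within {0..t})" if "s \<in> {0..t}" for s
      using dr[OF that] by (simp add: has_vector_derivative_def)
    show "onorm (\<lambda>h. h *\<^sub>R r' s) \<le> e * t ^ N" if "s \<in> {0..t}" for s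
      using r'[OF that] e Suc.prems(1)
      by (intro onorm_le) (auto simp: mult.commute[of "\<bar>_\<bar>"] intro: mult_right_mono)
  qed (use Suc.prems(1) in auto)
  moreover have "r 0 = 0"
    by (simp add: r_def sum.atMost_Suc_shift del: sum.atMost_Suc)
  ultimately show ?case
    using Suc.prems(1) by (simp add: r_def mult_ac)
qed

text \<open>The filter of pairs \<open>(t, x)\<close> with \<open>t \<ge> 0\<close>, \<open>t \<rightarrow> 0\<close> and \<open>x \<rightarrow> xo\<close>.  The time \<open>t = 0\<close> is included, so that
  eventual properties hold on full rectangles \<open>[0, \<delta>] \<times> cball xo \<delta>\<close>.\<close>

definition start :: "'a::metric_space \<Rightarrow> (real \<times> 'a) filter" where
  "start xo = inf (nhds 0) (principal {0..}) \<times>\<^sub>F nhds xo"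

lemma eventually_start:
  "eventually P (start xo) \<longleftrightarrow> (\<exists>\<delta>>0. \<forall>t\<in>{0..\<delta>}. \<forall>x\<in>cball xo \<delta>. P (t, x))"
proof
  assume "eventually P (start xo)"
  then obtain Q S where Q: "eventually Q (inf (nhds 0) (principal {0..}))" "eventually S (nhds xo)"
    and P: "\<And>t x. Q t \<Longrightarrow> S x \<Longrightarrow> P (t, x)"
    by (auto simp: start_def eventually_prod_filter)
  obtain d e where "d > 0" "\<And>t. dist t 0 < d \<Longrightarrow> t \<ge> 0 \<Longrightarrow> Q t" "e > 0" "\<And>x. dist x xo < e \<Longrightarrow> S x"
    using Q unfolding eventually_inf_principal eventually_nhds_metric by auto
  then show "\<exists>\<delta>>0. \<forall>t\<in>{0..\<delta>}. \<forall>x\<in>cball xo \<delta>. P (t, x)"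
    using P by (intro exI[of _ "min d e / 2"]) (auto simp: dist_commute dist_real_def)
next
  assume "\<exists>\<delta>>0. \<forall>t\<in>{0..\<delta>}. \<forall>x\<in>cball xo \<delta>. P (t, x)"
  then obtain d where d: "d > 0" "\<And>t x. t \<in> {0..d} \<Longrightarrow> x \<in> cball xo d \<Longrightarrow> P (t, x)" by blast
  have "eventually (\<lambda>t. t \<in> {0..d}) (inf (nhds (0::real)) (principal {0..}))"
    unfolding eventually_inf_principal eventually_nhds_metric
    using d(1) by (intro exI[of _ d]) (auto simp: dist_real_def)
  moreover have "eventually (\<lambda>x. x \<in> cball xo d) (nhds xo)"
    unfolding eventually_nhds_metric
    using d(1) by (intro exI[of _ d]) (auto simp: dist_commute)
  ultimately show "eventually P (start xo)"
    using d(2) unfolding start_def eventually_prod_filter by blast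
qed

lemma eventually_start_snd: "eventually P (nhds xo) \<Longrightarrow> \<forall>\<^sub>F (t, x) in start xo. P x"
  unfolding start_def case_prod_unfold
  using eventually_compose_filterlim[OF _ filterlim_snd] by blast

lemma eventually_start_fst: "0 < d \<Longrightarrow> \<forall>\<^sub>F (t, x) in start xo. 0 \<le> t \<and> t \<le> d"
  unfolding eventually_start by auto

definition integral_curve :: "('a::euclidean_space \<Rightarrow> 'a) \<Rightarrow> 'a \<Rightarrow> (real \<Rightarrow> 'a) \<Rightarrow> bool" where
  "integral_curve f x y \<longleftrightarrow>
     y 0 = x \<and> (\<forall>t\<ge>0. (y has_vector_derivative f (y t)) (at t within {0..}))"

text \<open>Uniqueness of integral curves is not presupposed; some curve is chosen for each initial point.\<close>

definition flow :: "('a::euclidean_space \<Rightarrow> 'a) \<Rightarrow> real \<Rightarrow> 'a \<Rightarrow> 'a" where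
  "flow f t x = (SOME y. integral_curve f x y) t"

definition has_flow_near :: "'a::euclidean_space \<Rightarrow> ('a \<Rightarrow> 'a) \<Rightarrow> bool" where
  "has_flow_near xo f \<longleftrightarrow> (\<forall>x. integral_curve f x (\<lambda>t. flow f t x)) \<and>
     (\<exists>\<rho>>0. continuous_on ({0..\<rho>} \<times> cball xo \<rho>) (\<lambda>(t, x). flow f t x))"

definition multi_flow :: "('a::euclidean_space \<Rightarrow> 'a) list \<Rightarrow> real \<Rightarrow> 'a \<Rightarrow> 'a" where
  "multi_flow fs t x = fold (\<lambda>f. flow f t) fs x"

lemma multi_flow_simps [simp]:
  "multi_flow [] t x = x" "multi_flow (f # fs) t x = multi_flow fs t (flow f t x)"
  by (simp_all add: multi_flow_def)

text \<open>Expansions valid near \<open>xo\<close> can be applied after a first motion.\<close>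

lemma filterlim_start_motion:
  assumes "\<psi> 0 xo = xo" "\<rho> > 0" "continuous_on ({0..\<rho>} \<times> cball xo \<rho>) (\<lambda>(t, x). \<psi> t x)"
  shows "filterlim (\<lambda>(t, x). (t, \<psi> t x)) (start xo) (start xo)"
  unfolding filterlim_iff
proof (intro allI impI)
  fix P assume "eventually P (start xo)"
  then obtain d where d: "d > 0" "\<And>t x. t \<in> {0..d} \<Longrightarrow> x \<in> cball xo d \<Longrightarrow> P (t, x)"
    unfolding eventually_start by blast
  have "(0, xo) \<in> {0..\<rho>} \<times> cball xo \<rho>" using assms(2) by auto
  from assms(3)[unfolded continuous_on_iff, rule_format, OF this d(1)]
  obtain e where e: "e > 0"
    "\<And>p. p \<in> {0..\<rho>} \<times> cball xo \<rho> \<Longrightarrow> dist p (0, xo) < e \<Longrightarrow> dist ((\<lambda>(t, x). \<psi> t x) p) xo < d"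
    unfolding prod.case assms(1) by blast
  \<comment> \<open>the norm on the product is at most the sum of the two components\<close>
  define r where "r = min (min \<rho> d) (e / 3)"
  have "P (t, \<psi> t x)" if "t \<in> {0..r}" "x \<in> cball xo r" for t x
  proof (rule d)
    have "dist (t, x) (0, xo) \<le> dist t 0 + dist x xo"
      using sqrt_sum_squares_le_sum[of "dist t 0" "dist x xo"] by (simp add: dist_Pair_Pair)
    also have "\<dots> < e" using that e(1) by (auto simp: r_def dist_commute)
    finally have "dist (\<psi> t x) xo < d" using e(2)[of "(t, x)"] that by (auto simp: r_def)
    then show "\<psi> t x \<in> cball xo d" by (simp add: dist_commute)
    show "t \<in> {0..d}" using that by (auto simp: r_def)
  qed
  moreover have "r > 0" using d e assms(2) by (simp add: r_def)
  ultimately show "\<forall>\<^sub>F p in start xo. P (case p of (t, x) \<Rightarrow> (t, \<psi> t x))"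
    unfolding eventually_start by auto
qed

lemma flow_0: "has_flow_near xo f \<Longrightarrow> flow f 0 x = x"
  by (auto simp: has_flow_near_def integral_curve_def)

lemma filterlim_start_flow:
  assumes "has_flow_near xo f"
  shows "filterlim (\<lambda>(t, x). (t, flow f t x)) (start xo) (start xo)"
  using assms filterlim_start_motion[of "flow f" xo, OF flow_0[OF assms]] by (auto simp: has_flow_near_def)

lemma multi_flow_continuous:
  assumes "\<And>f. f \<in> set fs \<Longrightarrow> has_flow_near xo f"
  shows "\<exists>\<rho>>0. continuous_on ({0..\<rho>} \<times> cball xo \<rho>) (\<lambda>(t, x). multi_flow fs t x)"
  using assms
proof (induction fs)
  case Nil
  then show ?case by (auto intro!: exI[of _ 1] continuous_intros simp: case_prod_unfold)
next
  case (Cons f fs)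
  obtain \<rho> where \<rho>: "\<rho> > 0" "continuous_on ({0..\<rho>} \<times> cball xo \<rho>) (\<lambda>(t, x). multi_flow fs t x)"
    using Cons by auto
  obtain \<sigma> where \<sigma>: "\<sigma> > 0" "continuous_on ({0..\<sigma>} \<times> cball xo \<sigma>) (\<lambda>(t, x). flow f t x)"
    using Cons.prems[of f] by (auto simp: has_flow_near_def)
  have "eventually (\<lambda>p. p \<in> {0..\<rho>} \<times> cball xo \<rho>) (start xo)"
    unfolding eventually_start using \<rho>(1) by auto
  from eventually_compose_filterlim[OF this filterlim_start_flow[of xo f]] Cons.prems
  have "\<forall>\<^sub>F (t, x) in start xo. (t, flow f t x) \<in> {0..\<rho>} \<times> cball xo \<rho>"
    by (simp add: case_prod_unfold)
  then obtain \<delta> where \<delta>: "\<delta> > 0"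
    "\<And>t x. t \<in> {0..\<delta>} \<Longrightarrow> x \<in> cball xo \<delta> \<Longrightarrow> (t, flow f t x) \<in> {0..\<rho>} \<times> cball xo \<rho>"
    unfolding eventually_start by auto
  define r where "r = min \<delta> \<sigma>"
  have "continuous_on ({0..r} \<times> cball xo r) (\<lambda>p. (fst p, (\<lambda>(t, x). flow f t x) p))"
    by (intro continuous_intros continuous_on_subset[OF \<sigma>(2)]) (auto simp: r_def)
  then have "continuous_on ({0..r} \<times> cball xo r)
      (\<lambda>p. (\<lambda>(t, x). multi_flow fs t x) (fst p, (\<lambda>(t, x). flow f t x) p))"
    by (rule continuous_on_compose2[OF \<rho>(2)]) (use \<delta>(2) in \<open>force simp: r_def\<close>)
  moreover have "r > 0" using \<delta> \<sigma> by (simp add: r_def)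
  ultimately show ?case by (auto simp: case_prod_unfold intro!: exI[of _ r])
qed

text \<open>Along an integral curve \<open>y\<close> of \<open>f\<close> the derivatives of \<open>g \<circ> y\<close> are the functions
  \<open>(H\<^sub>f\<^sup>j g) \<circ> y\<close>.  The remainder is uniform in the initial point because \<open>H\<^sub>f\<^sup>N g\<close> is continuous at \<open>xo\<close>.\<close>

lemma taylor_flow:
  fixes g :: "'a::euclidean_space \<Rightarrow> 'b::real_normed_vector"
  assumes f: "has_flow_near xo f" "C_k (N - 1) f" and g: "C_k N g" and "\<eta> > 0"
  shows "\<forall>\<^sub>F (t, x) in start xo.
    norm (g (flow f t x) - (\<Sum>j\<le>N. (t ^ j / fact j) *\<^sub>R (lie_deriv f ^^ j) g x)) \<le> \<eta> * t ^ N"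
proof -
  define h where "h j = (lie_deriv f ^^ j) g" for j
  have C: "C_k (N - j) (h j)" if "j \<le> N" for j
    using C_k_lie_deriv_funpow[OF f(2), of "N - j" j g] g that by (simp add: h_def)
  have "isCont (h N) xo"
    using C[of N] by (simp add: continuous_on_eq_continuous_at)
  then have "\<forall>\<^sub>F x in nhds xo. dist (h N x) (h N xo) < \<eta> / 2"
    using \<open>\<eta> > 0\<close> unfolding isCont_def tendsto_at_iff_tendsto_nhds by (intro tendstoD) auto
  note near = eventually_start_snd[OF this]
  have "\<forall>\<^sub>F (t, x) in start xo. dist (h N (flow f t x)) (h N xo) < \<eta> / 2"
    using eventually_compose_filterlim[OF near filterlim_start_flow[OF f(1)]]
    by (simp add: case_prod_unfold)
  with near have "\<forall>\<^sub>F (t, x) in start xo. norm (h N (flow f t x) - h N x) \<le> \<eta>"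
    by eventually_elim (auto simp: dist_norm split: prod.splits, smt (verit) dist_norm dist_triangle2 field_sum_of_halves)
  then obtain \<delta> where \<delta>: "\<delta> > 0"
    "\<And>t x. t \<in> {0..\<delta>} \<Longrightarrow> x \<in> cball xo \<delta> \<Longrightarrow> norm (h N (flow f t x) - h N x) \<le> \<eta>"
    unfolding eventually_start by auto
  have "norm (g (flow f t x) - (\<Sum>j\<le>N. (t ^ j / fact j) *\<^sub>R h j x)) \<le> \<eta> * t ^ N"
    if t: "t \<in> {0..\<delta>}" and x: "x \<in> cball xo \<delta>" for t x
  proof -
    define y where "y s = flow f s x" for s
    have y: "y 0 = x" "\<And>s. s \<ge> 0 \<Longrightarrow> (y has_vector_derivative f (y s)) (at s within {0..})"
      using f(1) by (auto simp: has_flow_near_def integral_curve_def y_def[abs_def])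
    have "norm (h 0 (y t) - (\<Sum>j\<le>N. (t ^ j / fact j) *\<^sub>R h j (y 0))) \<le> \<eta> * t ^ N"
    proof (rule taylor_curve[where c="\<lambda>j s. h j (y s)"])
      fix j s assume j: "j < N" and s: "s \<in> {0..t}"
      have "(h j has_derivative frechet_derivative (h j) (at (y s))) (at (y s) within y ` {0..t})"
        using C_k_differentiable[OF C[of j]] j frechet_derivative_works
        by (auto intro: has_derivative_at_withinI)
      moreover have "(y has_vector_derivative f (y s)) (at s within {0..t})"
        using y(2)[of s] s by (auto intro: has_vector_derivative_within_subset)
      ultimately have "(h j \<circ> y has_vector_derivative frechet_derivative (h j) (at (y s)) (f (y s)))
          (at s within {0..t})"
        by (rule vector_derivative_diff_chain_within[rotated])
      then show "((\<lambda>s. h j (y s)) has_vector_derivative h (Suc j) (y s)) (at s within {0..t})"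
        by (simp add: o_def h_def lie_deriv_def)
    next
      show "norm (h N (y s) - h N (y 0)) \<le> \<eta>" if "s \<in> {0..t}" for s
        using \<delta>(2)[of s x] that t x y(1) by (auto simp: y_def)
    qed (use t in auto)
    then show ?thesis by (simp add: h_def y_def flow_0[OF f(1)])
  qed
  then show ?thesis
    unfolding eventually_start h_def using \<delta>(1) by auto
qed


text \<open>Expand \<open>v\<close> along the later flows at the point reached by the first one, and then each
  coefficient, which is of class \<open>C\<^bsup>N - r\<^esup>\<close>, along the first flow up to the order \<open>N - r\<close>.\<close>

lemma multi_flow_taylor:
  fixes v :: "'a::euclidean_space \<Rightarrow> 'b::real_normed_vector"
  assumes "\<And>f. f \<in> set fs \<Longrightarrow> has_flow_near xo f \<and> C_k (N - 1) f" and "C_k N v" and "\<eta> > 0"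
  shows "\<forall>\<^sub>F (t, x) in start xo.
    norm (v (multi_flow fs t x) - (\<Sum>r\<le>N. (t ^ r / fact r) *\<^sub>R lie_boxplus fs r v x)) \<le> \<eta> * t ^ N"
  using assms
proof (induction fs arbitrary: \<eta>)
  case Nil
  have "(\<Sum>r\<le>N. (t ^ r / fact r) *\<^sub>R lie_boxplus [] r v x) = v x" for t x
  proof -
    have "(\<Sum>r\<le>N. (t ^ r / fact r) *\<^sub>R lie_boxplus [] r v x) = (\<Sum>r\<le>N. if r = 0 then v x else 0)"
      by (intro sum.cong) (auto simp: lie_boxplus_Nil)
    then show ?thesis by simp
  qed
  then show ?case
    using Nil unfolding eventually_start by (intro exI[of _ 1]) auto
next
  case (Cons f fs)
  define b where "b r = lie_boxplus fs r v" for r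
  define H where "H j r x = (lie_deriv f ^^ j) (b r) x" for j r x
  have f: "has_flow_near xo f" "C_k (N - 1) f" and fs: "\<And>g. g \<in> set fs \<Longrightarrow> has_flow_near xo g \<and> C_k (N - 1) g"
    using Cons.prems by auto
  define \<epsilon> where "\<epsilon> = \<eta> / (2 * real (Suc N))"
  have \<epsilon>: "\<epsilon> > 0" using Cons.prems by (simp add: \<epsilon>_def)
  have "\<forall>\<^sub>F (t, x) in start xo.
      norm (v (multi_flow fs t x) - (\<Sum>r\<le>N. (t ^ r / fact r) *\<^sub>R b r x)) \<le> \<eta> / 2 * t ^ N"
    unfolding b_def using Cons.IH[OF fs Cons.prems(2), of "\<eta> / 2"] Cons.prems(3) by simp
  from eventually_compose_filterlim[OF this filterlim_start_flow[OF f(1)]]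
  have 1: "\<forall>\<^sub>F (t, x) in start xo. norm (v (multi_flow (f # fs) t x) -
      (\<Sum>r\<le>N. (t ^ r / fact r) *\<^sub>R b r (flow f t x))) \<le> \<eta> / 2 * t ^ N"
    by (simp add: case_prod_unfold)
  have "\<forall>\<^sub>F (t, x) in start xo. norm (b r (flow f t x) -
      (\<Sum>j\<le>N - r. (t ^ j / fact j) *\<^sub>R H j r x)) \<le> \<epsilon> * t ^ (N - r)" if "r \<le> N" for r
    unfolding H_def using \<epsilon> f that Cons.prems(2) fs unfolding b_def
    by (intro taylor_flow C_k_lie_boxplus[of fs N] C_k_le[OF f(2)]) auto
  then have 2: "\<forall>\<^sub>F (t, x) in start xo. \<forall>r\<in>{..N}. norm (b r (flow f t x) -
      (\<Sum>j\<le>N - r. (t ^ j / fact j) *\<^sub>R H j r x)) \<le> \<epsilon> * t ^ (N - r)"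
    by (simp add: eventually_ball_finite_distrib case_prod_unfold)
  have expand: "(\<Sum>r\<le>N. (t ^ r / fact r) *\<^sub>R (\<Sum>j\<le>N - r. (t ^ j / fact j) *\<^sub>R H j r x)) =
      (\<Sum>n\<le>N. (t ^ n / fact n) *\<^sub>R lie_boxplus (f # fs) n v x)" for t x
  proof -
    have "(\<Sum>r\<le>N. (t ^ r / fact r) *\<^sub>R (\<Sum>j\<le>N - r. (t ^ j / fact j) *\<^sub>R H j r x)) =
       (\<Sum>(r, j)\<in>(SIGMA r:{..N}. {..N - r}). (t ^ (r + j) / (fact r * fact j)) *\<^sub>R H j r x)"
      by (subst sum.Sigma[symmetric]) (auto simp: scaleR_sum_right power_add)
    also have "(SIGMA r:{..N}. {..N - r}) = prod.swap ` {(j, r). j + r \<le> N}"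
      by force
    also have "(\<Sum>(r, j)\<in>\<dots>. (t ^ (r + j) / (fact r * fact j)) *\<^sub>R H j r x) =
        (\<Sum>(j, r)\<in>{(j, r). j + r \<le> N}. (t ^ (j + r) / (fact r * fact j)) *\<^sub>R H j r x)"
      by (subst sum.reindex) (auto simp: case_prod_unfold add.commute)
    also have "\<dots> = (\<Sum>n\<le>N. \<Sum>j\<le>n. (t ^ (j + (n - j)) / (fact (n - j) * fact j)) *\<^sub>R H j (n - j) x)"
      by (rule sum.triangle_reindex_eq)
    also have "\<dots> = (\<Sum>n\<le>N. (t ^ n / fact n) *\<^sub>R lie_boxplus (f # fs) n v x)"
    proof (intro sum.cong refl)
      fix n assume n: "n \<in> {..N}"
      have "C_k n v" using C_k_le[OF Cons.prems(2)] n by simp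
      then have "lie_boxplus (f # fs) n v x = (\<Sum>j\<le>n. of_nat (n choose j) *\<^sub>R H j (n - j) x)"
        unfolding H_def b_def using n Cons.prems(1)
        by (subst lie_boxplus_Cons[where N=N]) auto
      then show "(\<Sum>j\<le>n. (t ^ (j + (n - j)) / (fact (n - j) * fact j)) *\<^sub>R H j (n - j) x) =
          (t ^ n / fact n) *\<^sub>R lie_boxplus (f # fs) n v x"
        by (auto simp: scaleR_sum_right binomial_fact mult.commute intro!: sum.cong)
    qed
    finally show ?thesis .
  qed
  show ?case
    using 1 2 eventually_start_fst[OF zero_less_one, of xo]
  proof eventually_elim
    case (elim p)
    obtain t x where p: "p = (t, x)" by (cases p)
    have t: "0 \<le> t" using elim by (simp add: p)
    let ?b = "\<lambda>r. b r (flow f t x)" and ?T = "\<lambda>r. \<Sum>j\<le>N - r. (t ^ j / fact j) *\<^sub>R H j r x"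
    have "norm (\<Sum>r\<le>N. (t ^ r / fact r) *\<^sub>R (?b r - ?T r)) \<le> (\<Sum>r\<le>N. \<epsilon> * t ^ N)"
    proof (rule sum_norm_le)
      fix r assume r: "r \<in> {..N}"
      have "norm ((t ^ r / fact r) *\<^sub>R (?b r - ?T r)) \<le> t ^ r * (\<epsilon> * t ^ (N - r))"
        unfolding norm_scaleR using elim(2) r t \<epsilon>
        by (intro mult_mono) (auto simp: p divide_le_eq mult_le_cancel_left1)
      also have "\<dots> = \<epsilon> * t ^ N"
        using r by (simp flip: power_add)
      finally show "norm ((t ^ r / fact r) *\<^sub>R (?b r - ?T r)) \<le> \<epsilon> * t ^ N" .
    qed
    also have "\<dots> = \<eta> / 2 * t ^ N"
      by (simp add: \<epsilon>_def del: of_nat_Suc) 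
    finally have "norm ((\<Sum>r\<le>N. (t ^ r / fact r) *\<^sub>R ?b r) -
        (\<Sum>n\<le>N. (t ^ n / fact n) *\<^sub>R lie_boxplus (f # fs) n v x)) \<le> \<eta> / 2 * t ^ N"
      by (simp add: scaleR_diff_right sum_subtractf flip: expand)
    moreover have "norm (v (multi_flow (f # fs) t x) - (\<Sum>r\<le>N. (t ^ r / fact r) *\<^sub>R ?b r)) \<le> \<eta> / 2 * t ^ N"
      using elim(1) by (simp add: p)
    ultimately have "norm (v (multi_flow (f # fs) t x) -
        (\<Sum>n\<le>N. (t ^ n / fact n) *\<^sub>R lie_boxplus (f # fs) n v x)) \<le> \<eta> / 2 * t ^ N + \<eta> / 2 * t ^ N"
      by (rule norm_diff_triangle_le[rotated])
    then show ?case by (simp add: p)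
  qed
qed

lemma differentiable_imp_lipschitz_at:
  fixes g :: "'a::real_normed_vector \<Rightarrow> 'b::real_normed_vector"
  assumes "g differentiable at xo"
  shows "\<exists>K>0. \<forall>\<^sub>F x in nhds xo. norm (g x - g xo) \<le> K * norm (x - xo)"
proof -
  obtain g' where g': "(g has_derivative g') (at xo)"
    using assms by (auto simp: differentiable_def)
  then obtain d where d: "d > 0" "\<And>y. norm (y - xo) < d \<Longrightarrow>
      norm (g y - g xo - g' (y - xo)) \<le> 1 * norm (y - xo)"
    unfolding has_derivative_at_alt by (meson zero_less_one)
  obtain K where K: "K > 0" "\<And>h. norm (g' h) \<le> norm h * K"
    using bounded_linear.pos_bounded[OF has_derivative_bounded_linear[OF g']] by blast
  have "norm (g y - g xo) \<le> (K + 1) * norm (y - xo)" if "dist y xo < d" for y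
    using d(2)[of y] K(2)[of "y - xo"] that norm_triangle_ineq[of "g y - g xo - g' (y - xo)" "g' (y - xo)"]
    by (simp add: dist_norm algebra_simps)
  then show ?thesis
    using K(1) d(1) unfolding eventually_nhds_metric by (intro exI[of _ "K + 1"]) auto
qed

text \<open>The coefficients of order \<open>1 \<le> r < N\<close> are differentiable and vanish at \<open>xo\<close>; with the factor
  \<open>t\<^sup>r\<close> they contribute \<open>o(|x - xo|)\<close>.\<close>

lemma multi_flow_expansion:
  fixes v :: "'a::euclidean_space \<Rightarrow> 'b::real_normed_vector"
  assumes fs: "\<And>f. f \<in> set fs \<Longrightarrow> has_flow_near xo f \<and> C_k (N - 1) f" and v: "C_k N v" and "N > 0"
    and zero: "\<And>r. 1 \<le> r \<Longrightarrow> r < N \<Longrightarrow> lie_boxplus fs r v xo = 0"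
    and a: "a = (1 / fact N) *\<^sub>R lie_boxplus fs N v xo" and "\<eta> > 0"
  shows "\<forall>\<^sub>F (t, x) in start xo.
    norm (v (multi_flow fs t x) - v x - t ^ N *\<^sub>R a) \<le> \<eta> * (t ^ N + norm (x - xo))"
proof -
  define b where "b r = lie_boxplus fs r v" for r
  have C: "C_k (N - r) (b r)" if "r \<le> N" for r
    unfolding b_def using C_k_lie_boxplus[of fs N "N - r" r v] fs v that by simp
  have 1: "\<forall>\<^sub>F (t, x) in start xo.
    norm (v (multi_flow fs t x) - (\<Sum>r\<le>N. (t ^ r / fact r) *\<^sub>R b r x)) \<le> \<eta> / 2 * t ^ N"
    unfolding b_def using fs v \<open>\<eta> > 0\<close> by (intro multi_flow_taylor) auto
  have "isCont (b N) xo"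
    using C[of N] by (simp add: continuous_on_eq_continuous_at)
  then have "\<forall>\<^sub>F x in nhds xo. dist (b N x) (b N xo) < \<eta> / 2"
    using \<open>\<eta> > 0\<close> unfolding isCont_def tendsto_at_iff_tendsto_nhds by (intro tendstoD) auto
  note 2 = eventually_start_snd[OF this]
  have "\<forall>\<^sub>F (t, x) in start xo. norm (t ^ r *\<^sub>R b r x) \<le> \<eta> / N * norm (x - xo)"
    if r: "r \<in> {1..<N}" for r
  proof -
    have "b r differentiable at xo" using C_k_differentiable[OF C[of r]] r by simp
    then obtain K where K: "K > 0" "\<forall>\<^sub>F x in nhds xo. norm (b r x - b r xo) \<le> K * norm (x - xo)"
      using differentiable_imp_lipschitz_at by blast
    have d: "min 1 (\<eta> / (N * K)) > 0" using \<open>\<eta> > 0\<close> \<open>N > 0\<close> K by simp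
    show ?thesis
      using eventually_start_snd[OF K(2)] eventually_start_fst[OF d]
    proof eventually_elim
      case (elim p)
      obtain t x where p: "p = (t, x)" by (cases p)
      have t: "0 \<le> t" "t \<le> 1" "t \<le> \<eta> / (N * K)" using elim by (auto simp: p)
      have "norm (b r x) \<le> K * norm (x - xo)" using elim(1) zero[of r] r by (simp add: p b_def)
      moreover have "t ^ r \<le> t" using power_decreasing[of 1 r t] t r by simp
      ultimately have "norm (t ^ r *\<^sub>R b r x) \<le> t * (K * norm (x - xo))"
        using t by (simp add: mult_mono)
      also have "\<dots> \<le> \<eta> / (N * K) * (K * norm (x - xo))"
        using t K by (intro mult_right_mono) auto
      also have "\<dots> = \<eta> / N * norm (x - xo)" using K by simp
      finally show ?case by (simp add: p)
    qed
  qed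
  then have 3: "\<forall>\<^sub>F (t, x) in start xo. \<forall>r\<in>{1..<N}. norm (t ^ r *\<^sub>R b r x) \<le> \<eta> / N * norm (x - xo)"
    by (simp add: eventually_ball_finite_distrib case_prod_unfold)
  show ?thesis
    using 1 2 3 eventually_start_fst[OF zero_less_one, of xo]
  proof eventually_elim
    case (elim p)
    obtain t x where p: "p = (t, x)" by (cases p)
    have t: "0 \<le> t" using elim by (auto simp: p)
    \<comment> \<open>the terms of order 0 and N are separated from the vanishing ones\<close>
    have split: "(\<Sum>r\<le>N. (t ^ r / fact r) *\<^sub>R b r x) =
        v x + (\<Sum>r\<in>{1..<N}. (t ^ r / fact r) *\<^sub>R b r x) + (t ^ N / fact N) *\<^sub>R b N x"
    proof -
      have "{..N} = insert 0 (insert N {1..<N})" using \<open>N > 0\<close> by auto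
      then show ?thesis using \<open>N > 0\<close> by (simp add: b_def lie_boxplus_0 algebra_simps)
    qed
    have "norm ((t ^ r / fact r) *\<^sub>R b r x) \<le> \<eta> / N * norm (x - xo)" if "r \<in> {1..<N}" for r
    proof -
      have "norm ((t ^ r / fact r) *\<^sub>R b r x) = norm (t ^ r *\<^sub>R b r x) / fact r" by simp
      also have "\<dots> \<le> norm (t ^ r *\<^sub>R b r x)"
        by (simp add: divide_le_eq mult_le_cancel_left1 del: norm_scaleR)
      also have "\<dots> \<le> \<eta> / N * norm (x - xo)" using elim(3) that by (simp add: p)
      finally show ?thesis .
    qed
    then have "norm (\<Sum>r\<in>{1..<N}. (t ^ r / fact r) *\<^sub>R b r x) \<le> (\<Sum>r\<in>{1..<N}. \<eta> / N * norm (x - xo))"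
      by (rule sum_norm_le)
    also have "\<dots> = real (N - 1) / N * (\<eta> * norm (x - xo))" by simp
    also have "\<dots> \<le> 1 * (\<eta> * norm (x - xo))"
      using \<open>\<eta> > 0\<close> \<open>N > 0\<close> by (intro mult_right_mono) auto
    finally have mid: "norm (\<Sum>r\<in>{1..<N}. (t ^ r / fact r) *\<^sub>R b r x) \<le> \<eta> * norm (x - xo)" by simp
    have "norm ((t ^ N / fact N) *\<^sub>R b N x - t ^ N *\<^sub>R a) = t ^ N / fact N * dist (b N x) (b N xo)"
      using t by (simp add: a b_def dist_norm flip: scaleR_diff_right divide_inverse)
    also have "\<dots> \<le> t ^ N * (\<eta> / 2)"
      using elim(2) t by (intro mult_mono) (auto simp: p divide_le_eq mult_le_cancel_left1)
    finally have top: "norm ((t ^ N / fact N) *\<^sub>R b N x - t ^ N *\<^sub>R a) \<le> t ^ N * (\<eta> / 2)" .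
    define e where "e = v (multi_flow fs t x) - (\<Sum>r\<le>N. (t ^ r / fact r) *\<^sub>R b r x)"
    have "v (multi_flow fs t x) - v x - t ^ N *\<^sub>R a = e + (\<Sum>r\<in>{1..<N}. (t ^ r / fact r) *\<^sub>R b r x)
        + ((t ^ N / fact N) *\<^sub>R b N x - t ^ N *\<^sub>R a)"
      unfolding e_def split by simp
    also have "norm \<dots> \<le> \<eta> / 2 * t ^ N + \<eta> * norm (x - xo) + t ^ N * (\<eta> / 2)"
      using elim(1) mid top by (intro norm_triangle_mono) (auto simp: p e_def)
    finally show ?case by (simp add: p algebra_simps)
  qed
qed

section \<open>Trajectories and dynamic programming\<close>

lemma min_time_leI:
  assumes "\<alpha> \<in> controls A" "trajectory F x \<alpha> y" "0 \<le> t" "y t \<in> \<T>"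
  shows "min_time A F \<T> x \<le> ereal t"
  unfolding min_time_def hitting_time_def
  using assms by (intro INF_lower2[of "(\<alpha>, y)"]) (auto intro: INF_lower)

lemma min_time_lessE:
  assumes "min_time A F \<T> x < c"
  obtains \<alpha> y t where "\<alpha> \<in> controls A" "trajectory F x \<alpha> y" "0 \<le> t" "y t \<in> \<T>" "ereal t < c"
  using assms unfolding min_time_def hitting_time_def by (auto simp: INF_less_iff)

lemma min_time_nonneg: "0 \<le> min_time A F \<T> x"
  unfolding min_time_def hitting_time_def by (auto intro!: INF_greatest)

lemma trajectory_0: "trajectory F x \<alpha> y \<Longrightarrow> y 0 = x"
  by (auto simp: trajectory_def dest: spec[of _ 0])

lemma trajectory_has_integral:
  assumes "trajectory F x \<alpha> y" "0 \<le> s" "s \<le> t"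
  shows "((\<lambda>r. F (y r) (\<alpha> r)) has_integral (y t - y s)) {s..t}"
proof -
  let ?g = "\<lambda>r. F (y r) (\<alpha> r)"
  have i: "?g integrable_on {0..t}"
    using assms absolutely_integrable_on_def by (force simp: trajectory_def)
  have "integral {0..s} ?g + integral {s..t} ?g = integral {0..t} ?g"
    using assms i by (intro Henstock_Kurzweil_Integration.integral_combine) auto
  moreover have "y t = x + integral {0..t} ?g" "y s = x + integral {0..s} ?g"
    using assms by (auto simp: trajectory_def)
  ultimately have "integral {s..t} ?g = y t - y s" by (simp add: algebra_simps)
  moreover have "?g integrable_on {s..t}"
    using integrable_on_subinterval[OF i] assms by auto
  ultimately show ?thesis by (metis integrable_integral)
qed

text \<open>On an interval of length at most \<open>1 / (2 L)\<close> the maximal distance \<open>D\<close> of the two trajectories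
  satisfies \<open>D \<le> d + D / 2\<close> with the initial distance \<open>d\<close>.  Iterated, this replaces Gronwall's
  inequality.\<close>

lemma trajectory_dist_short:
  assumes y: "trajectory F x \<alpha> y" and z: "trajectory F x' \<alpha> z" and \<alpha>: "\<alpha> \<in> controls A"
    and X: "lipschitz_in_state_on X A F L" "\<And>r. r \<in> {s..t} \<Longrightarrow> y r \<in> X \<and> z r \<in> X"
    and L: "0 \<le> L" "L * (t - s) \<le> 1 / 2" and s: "0 \<le> s" "s \<le> t"
  shows "norm (y t - z t) \<le> 2 * norm (y s - z s)"
proof -
  have "continuous_on {s..t} (\<lambda>r. norm (y r - z r))"
    using y z s by (intro continuous_intros) (auto simp: trajectory_def intro: continuous_on_subset)
  then obtain q where q: "q \<in> {s..t}" "\<And>r. r \<in> {s..t} \<Longrightarrow> norm (y r - z r) \<le> norm (y q - z q)"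
    using continuous_attains_sup[of "{s..t}"] s by force
  define D where "D = norm (y q - z q)"
  have "((\<lambda>r. F (y r) (\<alpha> r) - F (z r) (\<alpha> r)) has_integral ((y q - y s) - (z q - z s))) (cbox s q)"
    using trajectory_has_integral[OF y, of s q] trajectory_has_integral[OF z, of s q] q s
    by (auto intro: has_integral_diff)
  then have "norm ((y q - y s) - (z q - z s)) \<le> (L * D) * measure lborel (cbox s q)"
  proof (rule has_integral_bound_spike_finite[of _ "{0}", rotated 2])
    fix r assume r: "r \<in> cbox s q - {0}"
    then have "\<alpha> r \<in> A" using \<alpha> s by (auto simp: controls_def)
    then have "norm (F (y r) (\<alpha> r) - F (z r) (\<alpha> r)) \<le> L * norm (y r - z r)"
      using X r q by (auto simp: lipschitz_in_state_on_def)
    also have "\<dots> \<le> L * D" using q r L by (auto simp: D_def intro: mult_left_mono)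
    finally show "norm (F (y r) (\<alpha> r) - F (z r) (\<alpha> r)) \<le> L * D" .
  qed (use L in \<open>auto simp: D_def\<close>)
  also have "\<dots> \<le> (L * (t - s)) * D"
    using q L mult_left_mono[of "q - s" "t - s" "L * D"] by (auto simp: D_def algebra_simps)
  also have "\<dots> \<le> 1 / 2 * D"
    using L by (intro mult_right_mono) (auto simp: D_def)
  finally have "D \<le> norm (y s - z s) + 1 / 2 * D"
    unfolding D_def by norm
  then show ?thesis using q(2)[of t] s by (simp add: D_def)
qed

lemma trajectory_dist_iterated:
  assumes y: "trajectory F x \<alpha> y" and z: "trajectory F x' \<alpha> z" and \<alpha>: "\<alpha> \<in> controls A"
    and X: "lipschitz_in_state_on UNIV A F L" and L: "0 \<le> L" "0 \<le> h" "L * h \<le> 1 / 2"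
  shows "t \<in> {0..real n * h} \<Longrightarrow> norm (y t - z t) \<le> 2 ^ n * norm (x - x')"
proof (induction n arbitrary: t)
  case 0
  then show ?case using trajectory_0[OF y] trajectory_0[OF z] by simp
next
  case (Suc n)
  define s where "s = min t (real n * h)"
  have "norm (y t - z t) \<le> 2 * norm (y s - z s)"
  proof (rule trajectory_dist_short[OF y z \<alpha> X])
    have "t - s \<le> h" using Suc.prems L by (auto simp: s_def algebra_simps)
    then show "L * (t - s) \<le> 1 / 2" using L mult_left_mono[of "t - s" h L] by linarith
  qed (use Suc.prems L in \<open>auto simp: s_def\<close>)
  also have "norm (y s - z s) \<le> 2 ^ n * norm (x - x')"
    using Suc.prems L by (intro Suc.IH) (auto simp: s_def)
  finally show ?case by simp
qed

text \<open>One constant serves all controls and all initial points, over bounded times.\<close>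

lemma trajectory_dist:
  assumes X: "lipschitz_in_state_on UNIV A F L" and "0 < L"
  obtains K where "K \<ge> 1" "\<And>x x' \<alpha> y z t. trajectory F x \<alpha> y \<Longrightarrow> trajectory F x' \<alpha> z \<Longrightarrow> \<alpha> \<in> controls A \<Longrightarrow>
     t \<in> {0..\<tau>} \<Longrightarrow> norm (y t - z t) \<le> K * norm (x - x')"
proof -
  define n where "n = nat \<lceil>\<tau> * (2 * L)\<rceil>"
  have "\<tau> * (2 * L) \<le> real n" unfolding n_def by linarith
  then have n: "\<tau> \<le> real n * (1 / (2 * L))" using \<open>0 < L\<close> by (simp add: field_simps)
  show ?thesis
  proof (rule that[of "2 ^ n"])
    fix x x' \<alpha> y z t
    assume a: "trajectory F x \<alpha> y" "trajectory F x' \<alpha> z" "\<alpha> \<in> controls A" "t \<in> {0..\<tau>}"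
    then show "norm (y t - z t) \<le> 2 ^ n * norm (x - x')"
      using \<open>0 < L\<close> n by (intro trajectory_dist_iterated[OF a(1-3) X, of "1 / (2 * L)"]) auto
  qed auto
qed

text \<open>Measurability of the shifted control: translations preserve Lebesgue measurable sets.\<close>

lemma controls_concat:
  assumes \<alpha>: "\<alpha> \<in> controls A" and \<beta>: "\<beta> \<in> controls A" and "0 \<le> t"
  shows "(\<lambda>s. if s \<le> t then \<alpha> s else \<beta> (s - t)) \<in> controls A"
proof -
  have sh: "(\<lambda>s. s - t) \<in> lebesgue \<rightarrow>\<^sub>M lebesgue"
    using lebesgue_affine_measurable[of "\<lambda>_::real. 1::real" "-t"] by simp
  have "(\<lambda>s. s - t) \<in> lebesgue_on {t<..} \<rightarrow>\<^sub>M lebesgue_on {0<..}"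
    by (intro measurable_restrict_space3 sh) auto
  then have b: "(\<lambda>s. \<beta> (s - t)) \<in> borel_measurable (lebesgue_on {t<..})"
    using \<beta> measurable_compose[of "\<lambda>s. s - t"] by (auto simp: controls_def)
  have a: "\<alpha> \<in> borel_measurable (lebesgue_on {0<..})"
    using \<alpha> by (auto simp: controls_def)
  have "(\<lambda>s. if s \<le> t then \<alpha> s else \<beta> (s - t)) \<in> borel_measurable (lebesgue_on {0<..})"
  proof (subst measurable_If_restrict_space_iff)
    show "{s \<in> space (lebesgue_on {0<..}). s \<le> t} \<in> sets (lebesgue_on {0<..})"
    proof -
      have "{s \<in> space (lebesgue_on {0<..}). s \<le> t} = {0<..t}" by auto
      then show ?thesis by (simp only:) (auto simp: sets_restrict_space_iff)
    qed
    have 1: "restrict_space (lebesgue_on {0<..}) {s. s \<le> t} = lebesgue_on {0<..t}"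
      by (subst restrict_restrict_space) (auto intro!: arg_cong2[of _ _ _ _ restrict_space])
    have 2: "restrict_space (lebesgue_on {0<..}) {s. \<not> s \<le> t} = lebesgue_on {t<..}"
      using \<open>0 \<le> t\<close> by (subst restrict_restrict_space) (auto intro!: arg_cong2[of _ _ _ _ restrict_space])
    have "\<alpha> \<in> borel_measurable (lebesgue_on {0<..t})"
      using measurable_restrict_space1[OF a, of "{..t}"] 1 by (simp add: atMost_def)
    then show "\<alpha> \<in> borel_measurable (restrict_space (lebesgue_on {0<..}) {s. s \<le> t}) \<and>
      (\<lambda>s. \<beta> (s - t)) \<in> borel_measurable (restrict_space (lebesgue_on {0<..}) {s. \<not> s \<le> t})"
      unfolding 1 2 using b by blast
  qed
  then show ?thesis
    using \<alpha> \<beta> by (auto simp: controls_def)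
qed

text \<open>At the switching time the control takes the value \<open>\<alpha> t\<close>, since \<open>\<beta> 0\<close> may lie outside the
  control set.\<close>

lemma trajectory_concat:
  assumes y: "trajectory F x \<alpha> y" and z: "trajectory F (y t) \<beta> z" and "0 \<le> t"
  shows "trajectory F x (\<lambda>s. if s \<le> t then \<alpha> s else \<beta> (s - t)) (\<lambda>s. if s \<le> t then y s else z (s - t))"
proof -
  define \<gamma> where "\<gamma> s = (if s \<le> t then \<alpha> s else \<beta> (s - t))" for s
  define Y where "Y s = (if s \<le> t then y s else z (s - t))" for s
  define g where "g s = F (Y s) (\<gamma> s)" for s
  define h where "h s = F (z s) (\<beta> s)" for s
  have cy: "continuous_on {0..} y" and cz: "continuous_on {0..} z"
    using y z by (auto simp: trajectory_def)
  have z0: "z 0 = y t" using trajectory_0[OF z] .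
  have "continuous_on ({0..t} \<union> {t..}) Y"
    unfolding Y_def
  proof (rule continuous_on_cases)
    show "continuous_on {0..t} y" by (rule continuous_on_subset[OF cy]) auto
    show "continuous_on {t..} (\<lambda>s. z (s - t))"
      by (rule continuous_on_compose2[OF cz]) (auto intro!: continuous_intros)
  qed (auto simp: z0)
  then have cY: "continuous_on {0..} Y"
    using \<open>0 \<le> t\<close> by (auto elim: continuous_on_subset)
  have g1: "g absolutely_integrable_on {0..s} \<and> Y s = x + integral {0..s} g" if s: "s \<in> {0..t}" for s
  proof -
    have "g r = F (y r) (\<alpha> r)" if "r \<in> {0..s}" for r
      using that s by (simp add: g_def Y_def \<gamma>_def)
    then have "integral {0..s} g = integral {0..s} (\<lambda>r. F (y r) (\<alpha> r))"
      "g absolutely_integrable_on {0..s} \<longleftrightarrow> (\<lambda>r. F (y r) (\<alpha> r)) absolutely_integrable_on {0..s}"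
      by (auto intro!: integral_cong absolutely_integrable_spike_eq[of "{}"])
    then show ?thesis using y s by (auto simp: trajectory_def Y_def)
  qed
  have g2: "g absolutely_integrable_on {t..s} \<and> integral {t..s} g = Y s - y t" if s: "t < s" for s
  proof -
    have h: "h absolutely_integrable_on {0..s - t}" "z (s - t) = y t + integral {0..s - t} h"
      using z s by (auto simp: trajectory_def h_def[abs_def])
    have eq: "g r = h (r + - t)" if "r \<in> {t..s} - {t}" for r
      using that by (auto simp: g_def Y_def \<gamma>_def h_def)
    have "(h has_integral (z (s - t) - y t)) {0..s - t}"
      using h absolutely_integrable_on_def integrable_integral by fastforce
    from has_integral_shift_real_ivl[OF this, of "-t"]
    have "((\<lambda>r. h (r + - t)) has_integral (z (s - t) - y t)) {t..s}" by simp
    then have 1: "(g has_integral (z (s - t) - y t)) {t..s}"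
      using eq by (intro has_integral_spike_finite[of "{t}" "{t..s}" g "\<lambda>r. h (r + -t)"]) auto
    have "((\<lambda>r. norm (h r)) has_integral integral {0..s - t} (\<lambda>r. norm (h r))) {0..s - t}"
      using h(1) unfolding absolutely_integrable_on_def by (intro integrable_integral) auto
    from has_integral_shift_real_ivl[OF this, of "-t"]
    have "((\<lambda>r. norm (h (r + - t))) has_integral integral {0..s - t} (\<lambda>r. norm (h r))) {t..s}" by simp
    then have "((\<lambda>r. norm (g r)) has_integral integral {0..s - t} (\<lambda>r. norm (h r))) {t..s}"
      using eq by (intro has_integral_spike_finite[of "{t}" "{t..s}" "\<lambda>r. norm (g r)" "\<lambda>r. norm (h (r + -t))"]) auto
    then show ?thesis
      using 1 s by (auto simp: absolutely_integrable_on_def Y_def integral_unique)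
  qed
  have "g absolutely_integrable_on {0..s} \<and> Y s = x + integral {0..s} g" if "0 \<le> s" for s
  proof (cases "s \<le> t")
    case False
    have "{0..s} = {0..t} \<union> {t..s}" using False \<open>0 \<le> t\<close> by auto
    then have i: "g absolutely_integrable_on {0..s}"
      using absolutely_integrable_Un[of "{0..t}" g "{t..s}"] g1[of t] g2[of s] False \<open>0 \<le> t\<close> by auto
    then have "integral {0..t} g + integral {t..s} g = integral {0..s} g"
      using False \<open>0 \<le> t\<close> absolutely_integrable_on_def
      by (intro Henstock_Kurzweil_Integration.integral_combine) auto
    then show ?thesis
      using i g1[of t] g2[of s] False \<open>0 \<le> t\<close> by (auto simp: Y_def algebra_simps)
  qed (use g1 that in auto)
  then show ?thesis
    using cY unfolding trajectory_def g_def[abs_def] Y_def[abs_def] \<gamma>_def[abs_def] by blast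
qed

text \<open>Follow the given control up to the time \<open>t\<close> and a nearly optimal one afterwards.\<close>

lemma min_time_dynamic_programming:
  assumes "\<alpha> \<in> controls A" "trajectory F x \<alpha> y" "0 \<le> t"
  shows "min_time A F \<T> x \<le> ereal t + min_time A F \<T> (y t)"
proof (rule ereal_le_epsilon)
  fix e :: ereal assume e: "0 < e"
  show "min_time A F \<T> x \<le> ereal t + min_time A F \<T> (y t) + e"
  proof (cases "min_time A F \<T> (y t) = \<infinity> \<or> e = \<infinity>")
    case False
    then obtain c where c: "min_time A F \<T> (y t) = ereal c"
      using min_time_nonneg[of A F \<T> "y t"] by (cases "min_time A F \<T> (y t)") auto
    obtain e' where e': "e = ereal e'" "e' > 0" using False e by (cases e) auto
    have "min_time A F \<T> (y t) < ereal (c + e')" using c e' by simp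
    then obtain \<beta> z s where s: "\<beta> \<in> controls A" "trajectory F (y t) \<beta> z" "0 \<le> s" "z s \<in> \<T>" "ereal s < ereal (c + e')"
      by (elim min_time_lessE)
    have "z s = (\<lambda>s. if s \<le> t then y s else z (s - t)) (t + s)"
      using s trajectory_0[OF s(2)] by simp
    then have "min_time A F \<T> x \<le> ereal (t + s)"
      using s assms by (intro min_time_leI[OF controls_concat[OF assms(1) s(1)] trajectory_concat[OF assms(2) s(2)]]) auto
    also have "\<dots> \<le> ereal (t + (c + e'))" using s by simp
    finally show ?thesis using c e' by (simp add: add.assoc)
  qed (use e in auto)
qed

lemma const_control: "a \<in> A \<Longrightarrow> (\<lambda>_. a) \<in> controls A"
  by (simp add: controls_def)

lemma control_system_trajectory_exists:
  "control_system A F \<Longrightarrow> \<alpha> \<in> controls A \<Longrightarrow> \<exists>y. trajectory F x \<alpha> y"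
  unfolding control_system_def by meson

lemma min_time_on_target:
  assumes "control_system A F" "a \<in> A" "xo \<in> \<T>"
  shows "min_time A F \<T> xo = 0"
proof -
  obtain y where y: "trajectory F xo (\<lambda>_. a) y"
    using control_system_trajectory_exists[OF assms(1) const_control[OF assms(2)]] by blast
  then have "min_time A F \<T> xo \<le> ereal 0"
    using trajectory_0[OF y] assms by (intro min_time_leI[OF const_control y]) auto
  then show ?thesis using min_time_nonneg[of A F \<T> xo] by (metis antisym zero_ereal_def)
qed

section \<open>Available vector fields and their flows\<close>

lemma available_continuous:
  assumes "control_system A F" "available A F f"
  shows "continuous_on UNIV f"
proof -
  obtain a where a: "a \<in> A" "f = (\<lambda>x. F x a)"
    using assms(2) by (auto simp: available_def)
  have "continuous_on UNIV (\<lambda>x. (\<lambda>(x, a). F x a) (x, a))"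
    by (rule continuous_on_compose2[where t="UNIV \<times> A"])
      (use assms(1) a in \<open>auto simp: control_system_def intro!: continuous_intros\<close>)
  then show ?thesis by (simp add: a(2))
qed

lemma integral_curve_iff_trajectory:
  assumes f: "continuous_on UNIV f" and a: "\<And>x. f x = F x a"
  shows "integral_curve f x y \<longleftrightarrow> trajectory F x (\<lambda>_. a) y"
proof
  assume y: "trajectory F x (\<lambda>_. a) y"
  have c: "continuous_on {0..} (\<lambda>s. f (y s))"
    using y by (intro continuous_on_compose2[OF f]) (auto simp: trajectory_def)
  have "(y has_vector_derivative f (y t)) (at t within {0..})" if "0 \<le> t" for t
  proof -
    have "((\<lambda>u. integral {0..u} (\<lambda>s. f (y s))) has_vector_derivative f (y t)) (at t within {0..t + 1})"
      using that by (intro integral_has_vector_derivative continuous_on_subset[OF c]) auto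
    then have "((\<lambda>u. x + integral {0..u} (\<lambda>s. f (y s))) has_vector_derivative 0 + f (y t)) (at t within {0..t + 1})"
      by (intro has_vector_derivative_add has_vector_derivative_const)
    moreover have "x + integral {0..u} (\<lambda>s. f (y s)) = y u" if "u \<in> {0..t + 1}" for u
      using y that by (simp add: trajectory_def a)
    ultimately have "(y has_vector_derivative f (y t)) (at t within {0..t + 1})"
      using that by (auto elim!: has_vector_derivative_transform[rotated 2])
    moreover have "at t within {0..t + 1} = at t within {0..}"
      using that by (intro at_within_nhd[of t "{..<t + 1}"]) auto
    ultimately show ?thesis by simp
  qed
  then show "integral_curve f x y"
    using trajectory_0[OF y] by (simp add: integral_curve_def)
next
  assume y: "integral_curve f x y"
  then have d: "(y has_vector_derivative f (y t)) (at t within {0..})" if "0 \<le> t" for t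
    using that by (simp add: integral_curve_def)
  then have c: "continuous_on {0..} y"
    by (meson atLeast_iff continuous_on_eq_continuous_within has_vector_derivative_continuous)
  have i: "(\<lambda>s. f (y s)) absolutely_integrable_on {0..t}" for t
    by (intro absolutely_integrable_continuous_real continuous_on_compose2[OF f]
        continuous_on_subset[OF c]) auto
  have "y t = x + integral {0..t} (\<lambda>s. f (y s))" if "0 \<le> t" for t
  proof -
    have "((\<lambda>s. f (y s)) has_integral (y t - y 0)) {0..t}"
      using that d by (intro fundamental_theorem_of_calculus)
        (auto intro: has_vector_derivative_within_subset[where S="{0..}"])
    then show ?thesis using y by (simp add: integral_curve_def integral_unique)
  qed
  then show "trajectory F x (\<lambda>_. a) y"
    using c i unfolding trajectory_def a[symmetric] by blast
qed

lemma flow_trajectory: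
  assumes "control_system A F" "available A F f"
  obtains a where "a \<in> A" "\<And>x. trajectory F x (\<lambda>_. a) (\<lambda>t. flow f t x)"
    "\<And>x. integral_curve f x (\<lambda>t. flow f t x)" "\<And>x. f x = F x a"
proof -
  obtain a where a: "a \<in> A" "\<And>x. f x = F x a"
    using assms(2) by (auto simp: available_def)
  have iff: "integral_curve f x y \<longleftrightarrow> trajectory F x (\<lambda>_. a) y" for x y
    by (intro integral_curve_iff_trajectory available_continuous[OF assms] a(2))
  have "\<exists>y. integral_curve f x y" for x
    unfolding iff by (rule control_system_trajectory_exists[OF assms(1) const_control[OF a(1)]])
  then have "integral_curve f x (\<lambda>t. flow f t x)" for x
    unfolding flow_def by (metis eta_contract_eq someI_ex)
  then show ?thesis using that a iff by blast
qed

text \<open>The uniform bound on trajectories bounds the speed, hence for short times trajectories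
  from points near \<open>xo\<close> stay where the Lipschitz condition holds.\<close>

lemma available_has_flow_near:
  assumes sys: "control_system A F" "available A F f"
    and lip: "lipschitz_in_state_on (cball xo R) A F L" and "R > 0" "L > 0"
  shows "has_flow_near xo f"
proof -
  obtain a where a: "a \<in> A" "\<And>x. trajectory F x (\<lambda>_. a) (\<lambda>t. flow f t x)"
    "\<And>x. integral_curve f x (\<lambda>t. flow f t x)" "\<And>x. f x = F x a"
    using flow_trajectory[OF sys] by blast
  note ac = const_control[OF a(1)]
  have bd: "\<forall>K \<tau>. bounded K \<longrightarrow>
        (\<exists>M. \<forall>x\<in>K. \<forall>\<alpha>\<in>controls A. \<forall>y. trajectory F x \<alpha> y \<longrightarrow> (\<forall>t\<in>{0..\<tau>}. norm (y t) \<le> M))"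
    using sys(1) unfolding control_system_def by blast
  obtain M0 where bound: "\<And>x \<alpha> y t. x \<in> cball xo R \<Longrightarrow> \<alpha> \<in> controls A \<Longrightarrow> trajectory F x \<alpha> y \<Longrightarrow>
      t \<in> {0..1} \<Longrightarrow> norm (y t) \<le> M0"
    using bd[rule_format, OF bounded_cball, of xo R 1] by blast
  have M0: "flow f t x \<in> cball 0 M0" if "x \<in> cball xo R" "t \<in> {0..1}" for x t
    using bound[OF that(1) ac a(2) that(2)] by simp
  have "bounded (f ` cball 0 M0)"
    by (intro compact_imp_bounded compact_continuous_image compact_cball
        continuous_on_subset[OF available_continuous[OF sys]]) auto
  then obtain M where M: "M > 0" "\<And>x. x \<in> cball 0 M0 \<Longrightarrow> norm (f x) \<le> M"
    unfolding bounded_pos by blast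
  \<comment> \<open>in turn: start at distance at most R/2, travel at most R/2, apply the short-time comparison, stay in the range of the bound M0\<close>
  define \<rho> where "\<rho> = Min {R / 2, R / (2 * M), 1 / (2 * L), 1}"
  have \<rho>: "\<rho> > 0" "\<rho> \<le> R / 2" "\<rho> \<le> R / (2 * M)" "\<rho> \<le> 1 / (2 * L)" "\<rho> \<le> 1"
    using \<open>R > 0\<close> \<open>L > 0\<close> M by (auto simp: \<rho>_def)
  have speed: "norm (flow f t x - flow f s x) \<le> M * (t - s)"
    if x: "x \<in> cball xo \<rho>" and st: "0 \<le> s" "s \<le> t" "t \<le> \<rho>" for s t x
  proof -
    have "norm (flow f t x - flow f s x) \<le> M * measure lborel (cbox s t)"
      using trajectory_has_integral[OF a(2), of s t x] st M x M0[of x] \<rho> \<open>R > 0\<close>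
      by (intro has_integral_bound[of M "\<lambda>r. f (flow f r x)"]) (auto simp: a(4))
    then show ?thesis using st by simp
  qed
  have inside: "flow f t x \<in> cball xo R" if x: "x \<in> cball xo \<rho>" and t: "t \<in> {0..\<rho>}" for x t
  proof -
    have "norm (flow f t x - flow f 0 x) \<le> M * (t - 0)"
      using x t by (intro speed) auto
    also have "\<dots> \<le> M * (R / (2 * M))"
      using t \<rho> M by (intro mult_left_mono) auto
    finally have "dist (flow f t x) x \<le> R / 2"
      using M trajectory_0[OF a(2), of x] by (simp add: dist_norm)
    then show ?thesis using x \<rho> dist_triangle[of xo "flow f t x" x] by (simp add: dist_commute)
  qed
  have "norm (flow f t x - flow f t x') \<le> 2 * norm (x - x')"
    if x: "x \<in> cball xo \<rho>" "x' \<in> cball xo \<rho>" and t: "t \<in> {0..\<rho>}" for x x' t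
  proof -
    have "L * (t - 0) \<le> L * (1 / (2 * L))"
      using t \<rho> \<open>L > 0\<close> by (intro mult_left_mono) auto
    then have "norm (flow f t x - flow f t x') \<le> 2 * norm (flow f 0 x - flow f 0 x')"
      using x t \<open>L > 0\<close> inside by (intro trajectory_dist_short[OF a(2) a(2) ac lip]) auto
    then show ?thesis using trajectory_0[OF a(2)] by simp
  qed
  note lipx = this
  have "continuous_on ({0..\<rho>} \<times> cball xo \<rho>) (\<lambda>(t, x). flow f t x)"
    unfolding continuous_on_iff
  proof (intro ballI allI impI)
    fix p and e :: real assume p: "p \<in> {0..\<rho>} \<times> cball xo \<rho>" and e: "e > 0"
    obtain s z where sz: "p = (s, z)" by (cases p)
    have "dist (flow f t x) (flow f s z) < e"
      if tx: "t \<in> {0..\<rho>}" "x \<in> cball xo \<rho>" and d: "dist (t, x) (s, z) < e / (2 * (M + 2))" for t x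
    proof -
      have 1: "dist t s < e / (2 * (M + 2))" "dist x z < e / (2 * (M + 2))"
        using dist_fst_le[of "(t, x)" "(s, z)"] dist_snd_le[of "(t, x)" "(s, z)"] d by auto
      have "norm (flow f t x - flow f s x) \<le> M * \<bar>t - s\<bar>"
        using speed[of x s t] speed[of x t s] tx p sz by (auto simp: norm_minus_commute abs_if)
      then have "dist (flow f t x) (flow f s z) \<le> M * dist t s + 2 * dist x z"
        using lipx[of x z s] tx p sz norm_triangle_ineq[of "flow f t x - flow f s x" "flow f s x - flow f s z"]
        by (auto simp: dist_norm)
      also have "\<dots> < M * (e / (2 * (M + 2))) + 2 * (e / (2 * (M + 2)))"
        using 1 M by (intro add_strict_mono mult_strict_left_mono) auto
      also have "\<dots> = (M + 2) * (e / (2 * (M + 2)))" by (simp only: distrib_right)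
      also have "\<dots> = e / 2" using M by (simp add: field_simps)
      finally show ?thesis using e by simp
    qed
    then show "\<exists>d>0. \<forall>q\<in>{0..\<rho>} \<times> cball xo \<rho>. dist q p < d \<longrightarrow>
        dist (case q of (t, x) \<Rightarrow> flow f t x) (case p of (t, x) \<Rightarrow> flow f t x) < e"
      using M e sz by (intro exI[of _ "e / (2 * (M + 2))"]) auto
  qed
  then show ?thesis
    using a(3) \<rho>(1) by (auto simp: has_flow_near_def)
qed

lemma min_time_multi_flow:
  assumes sys: "control_system A F" and "\<And>f. f \<in> set fs \<Longrightarrow> available A F f" and "0 \<le> t"
  shows "min_time A F \<T> x \<le> ereal (real (length fs) * t) + min_time A F \<T> (multi_flow fs t x)"
  using assms(2)
proof (induction fs arbitrary: x)
  case (Cons f fs)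
  obtain a where a: "a \<in> A" "\<And>x. trajectory F x (\<lambda>_. a) (\<lambda>t. flow f t x)"
    using flow_trajectory[OF sys, of f] Cons.prems by (metis list.set_intros(1))
  have "min_time A F \<T> x \<le> ereal t + min_time A F \<T> (flow f t x)"
    using min_time_dynamic_programming[OF const_control[OF a(1)] a(2)] \<open>0 \<le> t\<close> by auto
  also have "\<dots> \<le> ereal t + (ereal (real (length fs) * t) + min_time A F \<T> (multi_flow fs t (flow f t x)))"
    using Cons by (intro add_left_mono Cons.IH) auto
  also have "\<dots> = ereal (real (length (f # fs)) * t) + min_time A F \<T> (multi_flow (f # fs) t x)"
    by (simp add: algebra_simps flip: add.assoc)
  finally show ?case .
qed simp

section \<open>Steering near a point\<close>

text \<open>Step \<open>i\<close> is a motion whose effect is of order \<open>k\<^sub>i\<close> in time; run for the time \<open>c\<^sub>i\<^bsup>1/k\<^sub>i\<^esup>\<close> its effect is,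
  to first order, linear in \<open>c\<^sub>i\<close>.\<close>

primrec steer :: "(nat \<Rightarrow> real \<Rightarrow> 'a \<Rightarrow> 'a) \<Rightarrow> (nat \<Rightarrow> nat) \<Rightarrow> (nat \<Rightarrow> real) \<Rightarrow> nat \<Rightarrow> 'a \<Rightarrow> 'a" where
  "steer \<psi> k c 0 x = x"
| "steer \<psi> k c (Suc n) x = \<psi> (Suc n) (root (k (Suc n)) (c (Suc n))) (steer \<psi> k c n x)"

text \<open>The region in which a step is applied shrinks to \<open>(0, xo)\<close> with the scale \<open>\<epsilon>\<close>: times are at most
  \<open>(\<epsilon> \<Lambda>)\<^bsup>1/\<kappa>\<^esup>\<close> and distances at most \<open>B \<epsilon>\<close>.\<close>

lemma eventually_start_scaled:
  assumes "\<forall>\<^sub>F (t, x) in start xo. P t x" and "0 < \<kappa>"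
  shows "\<forall>\<^sub>F \<epsilon> in at_right 0. \<forall>s x. 0 \<le> s \<and> s \<le> \<epsilon> * \<Lambda> \<and> x \<in> cball xo (B * \<epsilon>) \<longrightarrow> P (root \<kappa> s) x"
proof -
  obtain d where d: "d > 0" "\<And>t x. t \<in> {0..d} \<Longrightarrow> x \<in> cball xo d \<Longrightarrow> P t x"
    using assms(1) unfolding eventually_start by auto
  have "((\<lambda>\<epsilon>. root \<kappa> (\<epsilon> * \<Lambda>)) \<longlongrightarrow> root \<kappa> (0 * \<Lambda>)) (at_right 0)"
    by (intro tendsto_intros)
  then have 1: "\<forall>\<^sub>F \<epsilon> in at_right 0. root \<kappa> (\<epsilon> * \<Lambda>) < d"
    using d(1) by (intro order_tendstoD) auto
  have "((\<lambda>\<epsilon>. B * \<epsilon>) \<longlongrightarrow> B * 0) (at_right (0::real))"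
    by (intro tendsto_intros)
  then have "\<forall>\<^sub>F \<epsilon> in at_right 0. B * \<epsilon> < d"
    using d(1) by (intro order_tendstoD) auto
  with 1 show ?thesis
  proof eventually_elim
    case (elim \<epsilon>)
    show ?case
    proof (intro allI impI, elim conjE)
      fix s x assume s: "0 \<le> s" "s \<le> \<epsilon> * \<Lambda>" "x \<in> cball xo (B * \<epsilon>)"
      have "root \<kappa> s \<le> root \<kappa> (\<epsilon> * \<Lambda>)" using s \<open>0 < \<kappa>\<close> by simp
      then show "P (root \<kappa> s) x" using s elim real_root_pos_pos_le[of s \<kappa>] by (intro d(2)) auto
    qed
  qed
qed

text \<open>What is needed of the motions \<open>\<psi>\<^sub>i\<close>, abstracted from the vector fields: the leading behaviour of
  \<open>v\<close>, a bound of the same order for the displacement, and continuity.\<close>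

locale steering =
  fixes xo :: "'a::euclidean_space" and v :: "'a \<Rightarrow> 'b::real_normed_vector"
    and m :: nat and k :: "nat \<Rightarrow> nat" and \<psi> :: "nat \<Rightarrow> real \<Rightarrow> 'a \<Rightarrow> 'a" and a :: "nat \<Rightarrow> 'b"
  assumes k_pos: "i \<in> {1..m} \<Longrightarrow> 0 < k i"
    and expansion: "i \<in> {1..m} \<Longrightarrow> 0 < \<eta> \<Longrightarrow> \<forall>\<^sub>F (t, x) in start xo.
      norm (v (\<psi> i t x) - v x - t ^ k i *\<^sub>R a i) \<le> \<eta> * (t ^ k i + norm (x - xo))"
    and displacement: "i \<in> {1..m} \<Longrightarrow> \<exists>K\<ge>0. \<forall>\<^sub>F (t, x) in start xo.
      norm (\<psi> i t x - x) \<le> K * (t ^ k i + norm (x - xo))"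
    and continuous: "i \<in> {1..m} \<Longrightarrow>
      \<exists>\<rho>>0. continuous_on ({0..\<rho>} \<times> cball xo \<rho>) (\<lambda>(t, x). \<psi> i t x)"
begin

definition small_controls :: "real \<Rightarrow> (nat \<Rightarrow> real) \<Rightarrow> bool" where
  "small_controls b c \<longleftrightarrow> (\<forall>i\<in>{1..m}. 0 \<le> c i \<and> c i \<le> b)"

text \<open>Here the displacement bound enters: after finitely many steps the distance from \<open>xo\<close> is still
  of order \<open>\<epsilon>\<close>, so the expansion of \<open>v\<close> in the next step has an error \<open>o(\<epsilon>)\<close>.\<close>

lemma steer_near:
  assumes "n \<le> m" "0 \<le> \<Lambda>"
  shows "\<exists>B\<ge>0. \<forall>\<^sub>F \<epsilon> in at_right 0. \<forall>c x. small_controls (\<epsilon> * \<Lambda>) c \<and> x \<in> cball xo \<epsilon> \<longrightarrow>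
    steer \<psi> k c n x \<in> cball xo (B * \<epsilon>)"
  using assms(1)
proof (induction n)
  case 0
  show ?case by (rule exI[of _ 1]) auto
next
  case (Suc n)
  then obtain B where B: "B \<ge> 0" "\<forall>\<^sub>F \<epsilon> in at_right 0. \<forall>c x. small_controls (\<epsilon> * \<Lambda>) c \<and>
     x \<in> cball xo \<epsilon> \<longrightarrow> steer \<psi> k c n x \<in> cball xo (B * \<epsilon>)" by auto
  have n: "Suc n \<in> {1..m}" using Suc.prems by simp
  obtain K where K: "K \<ge> 0" "\<forall>\<^sub>F (t, x) in start xo.
      norm (\<psi> (Suc n) t x - x) \<le> K * (t ^ k (Suc n) + norm (x - xo))"
    using displacement[OF n] by blast
  note step = eventually_start_scaled[OF K(2) k_pos[OF n], where B=B and \<Lambda>=\<Lambda>]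
  have "\<forall>\<^sub>F \<epsilon> in at_right 0. \<forall>c x. small_controls (\<epsilon> * \<Lambda>) c \<and>
     x \<in> cball xo \<epsilon> \<longrightarrow> steer \<psi> k c (Suc n) x \<in> cball xo ((B + K * (\<Lambda> + B)) * \<epsilon>)"
    using B(2) step
  proof eventually_elim
    case (elim \<epsilon>)
    show ?case
    proof (intro allI impI, elim conjE)
      fix c x assume c: "small_controls (\<epsilon> * \<Lambda>) c" and x: "x \<in> cball xo \<epsilon>"
      define z where "z = steer \<psi> k c n x"
      let ?s = "c (Suc n)"
      have s: "0 \<le> ?s" "?s \<le> \<epsilon> * \<Lambda>" using c n by (auto simp: small_controls_def)
      have z: "z \<in> cball xo (B * \<epsilon>)" using elim(1) c x by (simp add: z_def)
      have "norm (steer \<psi> k c (Suc n) x - z) \<le> K * (root (k (Suc n)) ?s ^ k (Suc n) + norm (z - xo))"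
        using elim(2) s z by (simp add: z_def)
      also have "\<dots> \<le> K * (\<epsilon> * \<Lambda> + B * \<epsilon>)"
        using s z K(1) k_pos[OF n]
        by (intro mult_left_mono add_mono) (auto simp: dist_norm norm_minus_commute)
      finally have "dist (steer \<psi> k c (Suc n) x) z \<le> K * (\<epsilon> * \<Lambda> + B * \<epsilon>)" by (simp add: dist_norm)
      then have "dist xo (steer \<psi> k c (Suc n) x) \<le> B * \<epsilon> + K * (\<epsilon> * \<Lambda> + B * \<epsilon>)"
        using z dist_triangle[of xo "steer \<psi> k c (Suc n) x" z] by (simp add: dist_commute)
      then show "steer \<psi> k c (Suc n) x \<in> cball xo ((B + K * (\<Lambda> + B)) * \<epsilon>)"
        by (simp add: algebra_simps)
    qed
  qed
  then show ?case using B(1) K(1) assms(2) by (intro exI[of _ "B + K * (\<Lambda> + B)"]) auto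
qed

lemma steer_expansion:
  assumes "n \<le> m" "0 \<le> \<Lambda>" "0 < \<eta>"
  shows "\<forall>\<^sub>F \<epsilon> in at_right 0. \<forall>c x. small_controls (\<epsilon> * \<Lambda>) c \<and> x \<in> cball xo \<epsilon> \<longrightarrow>
    norm (v (steer \<psi> k c n x) - v x - (\<Sum>i\<in>{1..n}. c i *\<^sub>R a i)) \<le> \<eta> * \<epsilon>"
  using assms(1,3)
proof (induction n arbitrary: \<eta>)
  case 0
  then show ?case by (auto intro: eventually_at_rightI[of 0 1])
next
  case (Suc n)
  have n: "Suc n \<in> {1..m}" using Suc.prems by simp
  obtain B where B: "B \<ge> 0" "\<forall>\<^sub>F \<epsilon> in at_right 0. \<forall>c x. small_controls (\<epsilon> * \<Lambda>) c \<and>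
     x \<in> cball xo \<epsilon> \<longrightarrow> steer \<psi> k c n x \<in> cball xo (B * \<epsilon>)"
    using steer_near[of n \<Lambda>] Suc.prems assms(2) by auto
  define X where "X = \<Lambda> + B + 1"
  define \<sigma> where "\<sigma> = \<eta> / (2 * X)"
  have X: "X > 0" using B(1) assms(2) by (simp add: X_def)
  then have \<sigma>: "\<sigma> > 0" using Suc.prems(2) by (simp add: \<sigma>_def)
  note step = eventually_start_scaled[OF expansion[OF n \<sigma>] k_pos[OF n], where B=B and \<Lambda>=\<Lambda>]
  have IH: "\<forall>\<^sub>F \<epsilon> in at_right 0. \<forall>c x. small_controls (\<epsilon> * \<Lambda>) c \<and> x \<in> cball xo \<epsilon> \<longrightarrow>
    norm (v (steer \<psi> k c n x) - v x - (\<Sum>i\<in>{1..n}. c i *\<^sub>R a i)) \<le> \<eta> / 2 * \<epsilon>"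
    using Suc by (intro Suc.IH) auto
  show ?case
    using B(2) step IH eventually_at_right_less[of "0::real"]
  proof eventually_elim
    case (elim \<epsilon>)
    show ?case
    proof (intro allI impI, elim conjE)
      fix c x assume c: "small_controls (\<epsilon> * \<Lambda>) c" and x: "x \<in> cball xo \<epsilon>"
      define z where "z = steer \<psi> k c n x"
      let ?s = "c (Suc n)" and ?k = "k (Suc n)"
      have s: "0 \<le> ?s" "?s \<le> \<epsilon> * \<Lambda>" using c n by (auto simp: small_controls_def)
      have rk: "root ?k ?s ^ ?k = ?s" using s k_pos[OF n] by simp
      have z: "z \<in> cball xo (B * \<epsilon>)" using elim(1) c x by (simp add: z_def)
      define d where "d = v (steer \<psi> k c (Suc n) x) - v z - ?s *\<^sub>R a (Suc n)"
      define e where "e = v z - v x - (\<Sum>i\<in>{1..n}. c i *\<^sub>R a i)"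
      have "norm d \<le> \<sigma> * (?s + norm (z - xo))"
        using elim(2)[rule_format, of ?s z] s z rk by (simp add: d_def z_def)
      also have "\<dots> \<le> \<sigma> * (\<epsilon> * \<Lambda> + B * \<epsilon>)"
        using s z \<sigma> by (intro mult_left_mono add_mono) (auto simp: dist_norm norm_minus_commute)
      also have "\<dots> \<le> \<sigma> * (X * \<epsilon>)"
        using \<sigma> elim(4) by (intro mult_left_mono) (auto simp: X_def algebra_simps)
      also have "\<dots> = \<eta> / 2 * \<epsilon>"
        using X by (simp add: \<sigma>_def)
      finally have "norm d \<le> \<eta> / 2 * \<epsilon>" .
      moreover have "norm e \<le> \<eta> / 2 * \<epsilon>" using elim(3) c x by (simp add: e_def z_def)
      ultimately have "norm (d + e) \<le> \<eta> / 2 * \<epsilon> + \<eta> / 2 * \<epsilon>" by (rule norm_triangle_mono)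
      moreover have "v (steer \<psi> k c (Suc n) x) - v x - (\<Sum>i\<in>{1..Suc n}. c i *\<^sub>R a i) = d + e"
        by (simp add: d_def e_def)
      ultimately show "norm (v (steer \<psi> k c (Suc n) x) - v x - (\<Sum>i\<in>{1..Suc n}. c i *\<^sub>R a i)) \<le> \<eta> * \<epsilon>"
        by (simp add: mult.commute)
    qed
  qed
qed

lemma steer_continuous:
  assumes "n \<le> m" "0 \<le> \<Lambda>"
  shows "\<forall>\<^sub>F \<epsilon> in at_right 0. \<forall>(S :: 'p::topological_space set) c x.
    x \<in> cball xo \<epsilon> \<and> (\<forall>p\<in>S. small_controls (\<epsilon> * \<Lambda>) (c p)) \<and>
    (\<forall>i\<in>{1..m}. continuous_on S (\<lambda>p. c p i)) \<longrightarrow> continuous_on S (\<lambda>p. steer \<psi> k (c p) n x)"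
  using assms(1)
proof (induction n)
  case 0
  show ?case by auto
next
  case (Suc n)
  have n: "Suc n \<in> {1..m}" using Suc.prems by simp
  obtain B where B: "B \<ge> 0" "\<forall>\<^sub>F \<epsilon> in at_right 0. \<forall>c x. small_controls (\<epsilon> * \<Lambda>) c \<and>
     x \<in> cball xo \<epsilon> \<longrightarrow> steer \<psi> k c n x \<in> cball xo (B * \<epsilon>)"
    using steer_near[of n \<Lambda>] Suc.prems assms(2) by auto
  obtain \<rho> where \<rho>: "\<rho> > 0" "continuous_on ({0..\<rho>} \<times> cball xo \<rho>) (\<lambda>(t, x). \<psi> (Suc n) t x)"
    using continuous[OF n] by blast
  have "\<forall>\<^sub>F (t, x) in start xo. (t, x) \<in> {0..\<rho>} \<times> cball xo \<rho>"
    unfolding eventually_start using \<rho>(1) by auto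
  note step = eventually_start_scaled[OF this k_pos[OF n], where B=B and \<Lambda>=\<Lambda>]
  have IH: "\<forall>\<^sub>F \<epsilon> in at_right 0. \<forall>(S :: 'p set) c x.
    x \<in> cball xo \<epsilon> \<and> (\<forall>p\<in>S. small_controls (\<epsilon> * \<Lambda>) (c p)) \<and>
    (\<forall>i\<in>{1..m}. continuous_on S (\<lambda>p. c p i)) \<longrightarrow> continuous_on S (\<lambda>p. steer \<psi> k (c p) n x)"
    using Suc by auto
  show ?case
    using B(2) step IH
  proof eventually_elim
    case (elim \<epsilon>)
    show ?case
    proof (intro allI impI, elim conjE)
      fix S :: "'p set" and c x
      assume x: "x \<in> cball xo \<epsilon>" and c: "\<forall>p\<in>S. small_controls (\<epsilon> * \<Lambda>) (c p)"
        and cc: "\<forall>i\<in>{1..m}. continuous_on S (\<lambda>p. c p i)"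
      have 1: "continuous_on S (\<lambda>p. steer \<psi> k (c p) n x)" using elim(3) x c cc by blast
      have 2: "continuous_on S (\<lambda>p. root (k (Suc n)) (c p (Suc n)))"
        using cc n by (intro continuous_intros) auto
      have "(root (k (Suc n)) (c p (Suc n)), steer \<psi> k (c p) n x) \<in> {0..\<rho>} \<times> cball xo \<rho>"
        if p: "p \<in> S" for p
        using elim(1)[rule_format, of "c p" x] elim(2) c n p x unfolding small_controls_def by blast
      then have "continuous_on S (\<lambda>p. (\<lambda>(t, x). \<psi> (Suc n) t x) (root (k (Suc n)) (c p (Suc n)), steer \<psi> k (c p) n x))"
        by (intro continuous_on_compose2[OF \<rho>(2)] continuous_on_Pair 1 2) auto
      then show "continuous_on S (\<lambda>p. steer \<psi> k (c p) (Suc n) x)" by simp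
    qed
  qed
qed

text \<open>Brouwer's theorem for the map that subtracts from \<open>p\<close> the value of \<open>\<pi> (v - v xo) / \<epsilon>\<close> at the end point.
  Since \<open>\<Sum>\<^sub>i c\<^sub>i \<pi> a\<^sub>i = \<epsilon> p\<close>, the terms \<open>p\<close> cancel and the map sends a ball of radius \<open>\<rho>\<close>, independent
  of \<open>\<theta>\<close>, into itself.  The multiple \<open>\<theta> \<mu>\<close> makes the controls nonnegative without changing \<open>\<pi> v\<close> to
  first order; \<open>\<theta>\<close> is left free because the boundary case needs it large compared with \<open>D\<close>.\<close>

lemma steer_onto:
  fixes \<pi> :: "'b \<Rightarrow> 'h::euclidean_space" and N :: "nat \<Rightarrow> 'h \<Rightarrow> real"
  assumes \<pi>: "bounded_linear \<pi>" and v: "continuous_on UNIV v" "v differentiable at xo"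
    and \<mu>: "\<And>i. 1 \<le> \<mu> i" "(\<Sum>i\<in>{1..m}. \<mu> i *\<^sub>R \<pi> (a i)) = 0"
    and N: "\<And>i. bounded_linear (N i)" "\<And>p. (\<Sum>i\<in>{1..m}. N i p *\<^sub>R \<pi> (a i)) = p"
  shows "\<exists>\<theta>0 D \<rho>. \<forall>\<theta>\<ge>\<theta>0. \<exists>\<Lambda>\<ge>0. \<forall>\<^sub>F \<epsilon> in at_right 0. \<forall>x\<in>cball xo \<epsilon>. \<exists>p\<in>cball 0 \<rho>. \<exists>c.
    c = (\<lambda>i. \<epsilon> * (\<theta> * \<mu> i + N i p)) \<and> small_controls (\<epsilon> * \<Lambda>) c \<and>
    \<pi> (v (steer \<psi> k c m x)) = \<pi> (v xo) \<and>
    norm (v (steer \<psi> k c m x) - v xo - (\<Sum>i\<in>{1..m}. c i *\<^sub>R a i)) \<le> D * \<epsilon>"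
proof -
  obtain K where K: "K > 0" "\<forall>\<^sub>F x in nhds xo. norm (v x - v xo) \<le> K * norm (x - xo)"
    using differentiable_imp_lipschitz_at[OF v(2)] by blast
  have evK: "\<forall>\<^sub>F \<epsilon> in at_right 0. \<forall>x\<in>cball xo \<epsilon>. norm (v x - v xo) \<le> K * norm (x - xo)"
  proof -
    obtain d where "d > 0" "\<And>x. dist x xo < d \<Longrightarrow> norm (v x - v xo) \<le> K * norm (x - xo)"
      using K(2) unfolding eventually_nhds_metric by blast
    then show ?thesis by (intro eventually_at_rightI[of 0 d]) (auto simp: dist_commute)
  qed
  obtain P where P: "P > 0" "\<And>y. norm (\<pi> y) \<le> norm y * P"
    using bounded_linear.pos_bounded[OF \<pi>] by blast
  \<comment> \<open>the error of the expansion contributes 1, the initial deviation of v contributes K, and P bounds the projection\<close>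
  define \<rho> where "\<rho> = (1 + K) * P"
  have \<rho>: "\<rho> > 0" using K P by (simp add: \<rho>_def)
  obtain \<beta> where \<beta>: "\<And>i. \<beta> i \<ge> 0" "\<And>i p. p \<in> cball 0 \<rho> \<Longrightarrow> \<bar>N i p\<bar> \<le> \<beta> i"
  proof -
    obtain M where M: "\<And>i. M i > 0" "\<And>i p. norm (N i p) \<le> norm p * M i"
      using bounded_linear.pos_bounded[OF N(1)] by metis
    show ?thesis
    proof (rule that[of "\<lambda>i. \<rho> * M i"])
      show "\<bar>N i p\<bar> \<le> \<rho> * M i" if "p \<in> cball 0 \<rho>" for i p
      proof -
        have "norm (N i p) \<le> norm p * M i" by (rule M(2))
        also have "\<dots> \<le> \<rho> * M i" using that M(1)[of i] by (intro mult_right_mono) auto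
        finally show ?thesis by simp
      qed
    qed (use M(1) \<rho> in \<open>auto intro: less_imp_le\<close>)
  qed
  define \<theta>0 where "\<theta>0 = (\<Sum>i\<in>{1..m}. \<beta> i)"
  have "\<exists>\<Lambda>\<ge>0. \<forall>\<^sub>F \<epsilon> in at_right 0. \<forall>x\<in>cball xo \<epsilon>. \<exists>p\<in>cball 0 \<rho>. \<exists>c.
    c = (\<lambda>i. \<epsilon> * (\<theta> * \<mu> i + N i p)) \<and> small_controls (\<epsilon> * \<Lambda>) c \<and>
    \<pi> (v (steer \<psi> k c m x)) = \<pi> (v xo) \<and>
    norm (v (steer \<psi> k c m x) - v xo - (\<Sum>i\<in>{1..m}. c i *\<^sub>R a i)) \<le> (1 + K) * \<epsilon>" if \<theta>: "\<theta> \<ge> \<theta>0" for \<theta>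
  proof -
    have \<theta>\<beta>: "\<beta> i \<le> \<theta>" if "i \<in> {1..m}" for i
      using member_le_sum[of i "{1..m}" \<beta>] \<beta>(1) that \<theta> by (auto simp: \<theta>0_def)
    have "\<theta>0 \<ge> 0" using \<beta>(1) by (auto simp: \<theta>0_def intro: sum_nonneg)
    then have \<theta>': "\<theta> \<ge> 0" using \<theta> by simp
    define \<Lambda> where "\<Lambda> = (\<Sum>i\<in>{1..m}. \<theta> * \<mu> i + \<beta> i)"
    have summand: "0 \<le> \<theta> * \<mu> i + \<beta> i" for i
      using \<theta>' \<beta>(1)[of i] \<mu>(1)[of i] by simp
    then have \<Lambda>: "0 \<le> \<Lambda>" by (auto simp: \<Lambda>_def intro: sum_nonneg)
    have box: "small_controls (\<epsilon> * \<Lambda>) (\<lambda>i. \<epsilon> * (\<theta> * \<mu> i + N i p))" if "p \<in> cball 0 \<rho>" "\<epsilon> > 0" for p \<epsilon>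
      unfolding small_controls_def
    proof (intro ballI conjI)
      fix i assume i: "i \<in> {1..m}"
      have b: "- \<beta> i \<le> N i p" "N i p \<le> \<beta> i" using \<beta>(2)[OF that(1), of i] by auto
      have "\<theta> * 1 \<le> \<theta> * \<mu> i" using \<theta>' \<mu>(1) by (intro mult_left_mono)
      then show "0 \<le> \<epsilon> * (\<theta> * \<mu> i + N i p)"
        using \<theta>\<beta>[OF i] b that(2) by (intro mult_nonneg_nonneg) auto
      have "\<theta> * \<mu> i + \<beta> i \<le> \<Lambda>"
        unfolding \<Lambda>_def using member_le_sum[of i "{1..m}" "\<lambda>i. \<theta> * \<mu> i + \<beta> i"] i summand by auto
      then show "\<epsilon> * (\<theta> * \<mu> i + N i p) \<le> \<epsilon> * \<Lambda>"
        using b that(2) by (intro mult_left_mono) auto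
    qed
    have "\<forall>\<^sub>F \<epsilon> in at_right 0. \<forall>x\<in>cball xo \<epsilon>. \<exists>p\<in>cball 0 \<rho>. \<exists>c.
      c = (\<lambda>i. \<epsilon> * (\<theta> * \<mu> i + N i p)) \<and> small_controls (\<epsilon> * \<Lambda>) c \<and>
      \<pi> (v (steer \<psi> k c m x)) = \<pi> (v xo) \<and>
      norm (v (steer \<psi> k c m x) - v xo - (\<Sum>i\<in>{1..m}. c i *\<^sub>R a i)) \<le> (1 + K) * \<epsilon>"
      using steer_expansion[OF order_refl \<Lambda> zero_less_one]
        steer_continuous[OF order_refl \<Lambda>, where 'p='h] evK eventually_at_right_less[of "0::real"]
    proof eventually_elim
      case (elim \<epsilon>)
      show ?case
      proof
        fix x assume x: "x \<in> cball xo \<epsilon>"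
        define c where "c p = (\<lambda>i. \<epsilon> * (\<theta> * \<mu> i + N i p))" for p
        define e where "e p = v (steer \<psi> k (c p) m x) - v xo - (\<Sum>i\<in>{1..m}. c p i *\<^sub>R a i)" for p
        have small: "small_controls (\<epsilon> * \<Lambda>) (c p)" if "p \<in> cball 0 \<rho>" for p
          using box[OF that elim(4)] by (simp add: c_def)
        have e: "norm (e p) \<le> (1 + K) * \<epsilon>" if "p \<in> cball 0 \<rho>" for p
        proof -
          have "norm (v x - v xo) \<le> K * norm (x - xo)" using elim(3) x by blast
          also have "\<dots> \<le> K * \<epsilon>" using x K(1) by (simp add: dist_norm norm_minus_commute)
          finally have "norm (v (steer \<psi> k (c p) m x) - v x - (\<Sum>i\<in>{1..m}. c p i *\<^sub>R a i) + (v x - v xo)) \<le> 1 * \<epsilon> + K * \<epsilon>"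
            using elim(1) small[OF that] x by (intro norm_triangle_mono) auto
          then show ?thesis by (simp add: e_def algebra_simps)
        qed
        define T where "T p = p - (1 / \<epsilon>) *\<^sub>R (\<pi> (v (steer \<psi> k (c p) m x)) - \<pi> (v xo))" for p
        interpret \<pi>: bounded_linear \<pi> by (rule \<pi>)
        have T: "T p = - (1 / \<epsilon>) *\<^sub>R \<pi> (e p)" for p
        proof -
          have "\<pi> (\<Sum>i\<in>{1..m}. c p i *\<^sub>R a i) = \<epsilon> *\<^sub>R (\<theta> *\<^sub>R (\<Sum>i\<in>{1..m}. \<mu> i *\<^sub>R \<pi> (a i)) + (\<Sum>i\<in>{1..m}. N i p *\<^sub>R \<pi> (a i)))"
            by (simp add: \<pi>.sum \<pi>.scaleR \<pi>.add c_def scaleR_sum_right sum.distrib[symmetric] algebra_simps)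
          also have "\<dots> = \<epsilon> *\<^sub>R p" unfolding \<mu>(2) N(2) by simp
          finally have "\<pi> (e p) = \<pi> (v (steer \<psi> k (c p) m x)) - \<pi> (v xo) - \<epsilon> *\<^sub>R p"
            by (simp add: e_def \<pi>.diff)
          then show ?thesis
            using elim(4) by (simp add: T_def scaleR_diff_right)
        qed
        have "continuous_on (cball 0 \<rho>) (\<lambda>p. steer \<psi> k (c p) m x)"
        proof (rule elim(2)[rule_format], intro conjI ballI)
          show "continuous_on (cball 0 \<rho>) (\<lambda>p. c p i)" for i
            unfolding c_def
            by (intro continuous_on_mult continuous_on_add continuous_on_const
                linear_continuous_on N(1))
        qed (use x small in auto)
        then have "continuous_on (cball 0 \<rho>) T"
          unfolding T_def
          by (intro continuous_intros \<pi>.continuous_on continuous_on_compose2[OF v(1)]) auto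
        moreover have "T \<in> cball 0 \<rho> \<rightarrow> cball 0 \<rho>"
        proof
          fix p :: 'h assume p: "p \<in> cball 0 \<rho>"
          have "norm (T p) = (1 / \<epsilon>) * norm (\<pi> (e p))" using elim(4) by (simp add: T)
          also have "\<dots> \<le> (1 / \<epsilon>) * ((1 + K) * \<epsilon> * P)"
            using elim(4) P e[OF p] order_trans[OF P(2) mult_right_mono[of "norm (e p)" "(1 + K) * \<epsilon>" P]]
            by (intro mult_left_mono) auto
          also have "\<dots> = \<rho>" using elim(4) by (simp add: \<rho>_def)
          finally show "T p \<in> cball 0 \<rho>" by simp
        qed
        ultimately obtain p where p: "p \<in> cball 0 \<rho>" "T p = p"
          using brouwer_ball[OF \<rho>, of 0 T] by blast
        then have "\<pi> (v (steer \<psi> k (c p) m x)) = \<pi> (v xo)"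
          using elim(4) by (simp add: T_def)
        then show "\<exists>p\<in>cball 0 \<rho>. \<exists>c. c = (\<lambda>i. \<epsilon> * (\<theta> * \<mu> i + N i p)) \<and> small_controls (\<epsilon> * \<Lambda>) c \<and>
            \<pi> (v (steer \<psi> k c m x)) = \<pi> (v xo) \<and>
            norm (v (steer \<psi> k c m x) - v xo - (\<Sum>i\<in>{1..m}. c i *\<^sub>R a i)) \<le> (1 + K) * \<epsilon>"
          using p(1) small[OF p(1)] e[OF p(1)] unfolding c_def e_def by blast
      qed
    qed
    then show ?thesis using \<Lambda> by blast
  qed
  then show ?thesis by blast
qed

lemma steer_stays_near:
  assumes "0 \<le> \<Lambda>" "0 < R"
  shows "\<forall>\<^sub>F \<epsilon> in at_right 0. \<forall>c x. small_controls (\<epsilon> * \<Lambda>) c \<and> x \<in> cball xo \<epsilon> \<longrightarrow>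
    steer \<psi> k c m x \<in> cball xo R"
proof -
  obtain B where B: "B \<ge> 0" "\<forall>\<^sub>F \<epsilon> in at_right 0. \<forall>c x. small_controls (\<epsilon> * \<Lambda>) c \<and>
     x \<in> cball xo \<epsilon> \<longrightarrow> steer \<psi> k c m x \<in> cball xo (B * \<epsilon>)"
    using steer_near[OF order_refl assms(1)] by blast
  have "((\<lambda>\<epsilon>. B * \<epsilon>) \<longlongrightarrow> B * 0) (at_right (0::real))"
    by (intro tendsto_intros)
  then have "\<forall>\<^sub>F \<epsilon> in at_right 0. B * \<epsilon> < R"
    using assms(2) by (intro order_tendstoD) auto
  with B(2) show ?thesis
    by eventually_elim (meson less_imp_le mem_cball order_trans)
qed

end

section \<open>Reaching the target\<close>

text \<open>A linear right inverse; its coefficients may be negative.\<close>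

lemma spanning_linear_coefficients:
  fixes b :: "nat \<Rightarrow> 'h::euclidean_space"
  assumes "\<And>p. \<exists>\<mu>::nat \<Rightarrow> real. p = (\<Sum>i\<in>{1..m}. \<mu> i *\<^sub>R b i)"
  obtains N where "\<And>i. bounded_linear (N i :: 'h \<Rightarrow> real)" "\<And>p. (\<Sum>i\<in>{1..m}. N i p *\<^sub>R b i) = p"
proof -
  obtain \<mu> :: "'h \<Rightarrow> nat \<Rightarrow> real" where \<mu>: "\<And>p. p = (\<Sum>i\<in>{1..m}. \<mu> p i *\<^sub>R b i)"
    using assms by metis
  define N where "N i p = (\<Sum>e\<in>Basis. (p \<bullet> e) * \<mu> e i)" for i p
  have "(\<Sum>i\<in>{1..m}. N i p *\<^sub>R b i) = p" for p
  proof -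
    have "(\<Sum>i\<in>{1..m}. N i p *\<^sub>R b i) = (\<Sum>e\<in>Basis. (p \<bullet> e) *\<^sub>R (\<Sum>i\<in>{1..m}. \<mu> e i *\<^sub>R b i))"
      unfolding N_def scaleR_sum_left scaleR_sum_right by (subst sum.swap) simp
    then show ?thesis unfolding \<mu>[symmetric] by (simp add: euclidean_representation)
  qed
  moreover have "bounded_linear (N i)" for i
    unfolding N_def
    by (intro bounded_linear_sum bounded_linear_mult_const bounded_linear_inner_left)
  ultimately show ?thesis using that by blast
qed

text \<open>The representation of \<open>- \<Sum>\<^sub>i a\<^sub>i\<close> in the positive basis gives a relation \<open>\<Sum>\<^sub>i \<mu>\<^sub>i a\<^sub>i = 0\<close> with all
  \<open>\<mu>\<^sub>i \<ge> 1\<close>, as required by \<open>steer_onto\<close> with \<open>\<pi>\<close> the identity.\<close>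

lemma steer_reaches_level_set:
  fixes u :: "'a::euclidean_space \<Rightarrow> 'h::euclidean_space"
  assumes st: "steering xo u m k \<psi> a" and u: "continuous_on UNIV u" "u differentiable at xo" and "0 < R"
    and \<T>: "\<T> \<inter> cball xo R = {x \<in> cball xo R. u x = u xo}" and basis: "positive_basis m a"
  shows "\<exists>\<Lambda>\<ge>0. \<forall>\<^sub>F \<epsilon> in at_right 0. \<forall>x\<in>cball xo \<epsilon>.
    \<exists>c. (\<forall>i\<in>{1..m}. 0 \<le> c i \<and> c i \<le> \<epsilon> * \<Lambda>) \<and> steer \<psi> k c m x \<in> \<T>"
proof -
  interpret steering xo u m k \<psi> a by (rule st)
  have "\<exists>\<mu>::nat \<Rightarrow> real. p = (\<Sum>i\<in>{1..m}. \<mu> i *\<^sub>R a i)" for p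
    using basis unfolding positive_basis_def by blast
  from spanning_linear_coefficients[OF this]
  obtain N where N: "\<And>i. bounded_linear (N i :: 'h \<Rightarrow> real)" "\<And>p. (\<Sum>i\<in>{1..m}. N i p *\<^sub>R a i) = p"
    by blast
  obtain \<nu> :: "nat \<Rightarrow> real" where \<nu>: "\<forall>i\<in>{1..m}. 0 \<le> \<nu> i" "- (\<Sum>i\<in>{1..m}. a i) = (\<Sum>i\<in>{1..m}. \<nu> i *\<^sub>R a i)"
    using basis unfolding positive_basis_def by blast
  \<comment> \<open>absolute values only matter outside the index range, where the coefficients are arbitrary\<close>
  define \<mu> where "\<mu> i = 1 + \<bar>\<nu> i\<bar>" for i
  have "(\<Sum>i\<in>{1..m}. \<mu> i *\<^sub>R a i) = (\<Sum>i\<in>{1..m}. a i) + (\<Sum>i\<in>{1..m}. \<nu> i *\<^sub>R a i)"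
    using \<nu>(1) by (simp add: \<mu>_def scaleR_add_left sum.distrib)
  also have "\<dots> = 0" unfolding \<nu>(2)[symmetric] by simp
  finally have \<mu>0: "(\<Sum>i\<in>{1..m}. \<mu> i *\<^sub>R a i) = 0" .
  have "\<exists>\<theta>0 D \<rho>. \<forall>\<theta>\<ge>\<theta>0. \<exists>\<Lambda>\<ge>0. \<forall>\<^sub>F \<epsilon> in at_right 0. \<forall>x\<in>cball xo \<epsilon>.
    \<exists>p\<in>cball 0 \<rho>. \<exists>c. c = (\<lambda>i. \<epsilon> * (\<theta> * \<mu> i + N i p)) \<and> small_controls (\<epsilon> * \<Lambda>) c \<and>
    u (steer \<psi> k c m x) = u xo \<and>
    norm (u (steer \<psi> k c m x) - u xo - (\<Sum>i\<in>{1..m}. c i *\<^sub>R a i)) \<le> D * \<epsilon>"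
    by (rule steer_onto[OF bounded_linear_ident u _ \<mu>0 N]) (simp add: \<mu>_def)
  then obtain \<theta>0 where "\<exists>\<Lambda>\<ge>0. \<forall>\<^sub>F \<epsilon> in at_right 0. \<forall>x\<in>cball xo \<epsilon>.
    \<exists>c. small_controls (\<epsilon> * \<Lambda>) c \<and> u (steer \<psi> k c m x) = u xo"
    by (fast elim: eventually_mono)
  then obtain \<Lambda> where \<Lambda>: "\<Lambda> \<ge> 0" "\<forall>\<^sub>F \<epsilon> in at_right 0. \<forall>x\<in>cball xo \<epsilon>.
    \<exists>c. small_controls (\<epsilon> * \<Lambda>) c \<and> u (steer \<psi> k c m x) = u xo"
    by blast
  have "\<forall>\<^sub>F \<epsilon> in at_right 0. \<forall>x\<in>cball xo \<epsilon>. \<exists>c. small_controls (\<epsilon> * \<Lambda>) c \<and> steer \<psi> k c m x \<in> \<T>"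
    using \<Lambda>(2) steer_stays_near[OF \<Lambda>(1) \<open>0 < R\<close>]
  proof eventually_elim
    case (elim \<epsilon>)
    show ?case
    proof
      fix x assume x: "x \<in> cball xo \<epsilon>"
      then obtain c where c: "small_controls (\<epsilon> * \<Lambda>) c" "u (steer \<psi> k c m x) = u xo"
        using elim(1) by blast
      then have "steer \<psi> k c m x \<in> \<T> \<inter> cball xo R"
        unfolding \<T> using elim(2) x by blast
      then show "\<exists>c. small_controls (\<epsilon> * \<Lambda>) c \<and> steer \<psi> k c m x \<in> \<T>" using c by blast
    qed
  qed
  then show ?thesis
    using \<Lambda>(1) unfolding small_controls_def by blast
qed

text \<open>As for the level set, with \<open>\<pi>\<close> the projection to the values of \<open>u\<close>.  The relation \<open>\<mu>\<close> is corrected by a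
  second one, \<open>\<nu>'\<close>, to have \<open>\<Sum>\<^sub>i \<mu>\<^sub>i snd (a\<^sub>i) \<ge> 1\<close>; a large multiple \<open>\<theta> \<mu>\<close> then outweighs all errors in \<open>w\<close>.\<close>

lemma steer_reaches_half_level_set:
  fixes u :: "'a::euclidean_space \<Rightarrow> real^'h" and w :: "'a \<Rightarrow> real"
  assumes st: "steering xo (\<lambda>x. (u x, w x)) m k \<psi> a"
    and v: "continuous_on UNIV (\<lambda>x. (u x, w x))" "(\<lambda>x. (u x, w x)) differentiable at xo" and "0 < R"
    and \<T>: "\<T> \<inter> cball xo R = {x \<in> cball xo R. u x = u xo \<and> w x \<ge> w xo}" and B2: "cond_B2_II m a"
  shows "\<exists>\<Lambda>\<ge>0. \<forall>\<^sub>F \<epsilon> in at_right 0. \<forall>x\<in>cball xo \<epsilon>.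
    \<exists>c. (\<forall>i\<in>{1..m}. 0 \<le> c i \<and> c i \<le> \<epsilon> * \<Lambda>) \<and> steer \<psi> k c m x \<in> \<T>"
proof -
  interpret steering xo "\<lambda>x. (u x, w x)" m k \<psi> a by (rule st)
  have cone: "\<exists>\<mu>::nat \<Rightarrow> real. (\<forall>i\<in>{1..m}. \<mu> i \<ge> 0) \<and>
        p = (\<Sum>i\<in>{1..m}. \<mu> i *\<^sub>R fst (a i)) \<and> r \<le> (\<Sum>i\<in>{1..m}. snd (a i) * \<mu> i)" if "0 \<le> r" for p r
    using B2 that unfolding cond_B2_II_def by blast
  have "\<exists>\<mu>::nat \<Rightarrow> real. p = (\<Sum>i\<in>{1..m}. \<mu> i *\<^sub>R fst (a i))" for p
    using cone[OF order_refl, of p] by blast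
  from spanning_linear_coefficients[OF this]
  obtain N where N: "\<And>i. bounded_linear (N i :: real^'h \<Rightarrow> real)" "\<And>p. (\<Sum>i\<in>{1..m}. N i p *\<^sub>R fst (a i)) = p"
    by blast
  obtain \<nu> :: "nat \<Rightarrow> real" where \<nu>: "\<forall>i\<in>{1..m}. 0 \<le> \<nu> i"
    "- (\<Sum>i\<in>{1..m}. fst (a i)) = (\<Sum>i\<in>{1..m}. \<nu> i *\<^sub>R fst (a i))"
    using cone[OF order_refl] by blast
  \<comment> \<open>the first-order effect on w of the uncorrected relation, possibly negative\<close>
  define S where "S = (\<Sum>i\<in>{1..m}. snd (a i) * (1 + \<bar>\<nu> i\<bar>))"
  have "0 \<le> \<bar>S\<bar> + 1" by simp
  from cone[OF this, of 0]
  obtain \<nu>' :: "nat \<Rightarrow> real" where \<nu>': "\<forall>i\<in>{1..m}. 0 \<le> \<nu>' i"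
    "0 = (\<Sum>i\<in>{1..m}. \<nu>' i *\<^sub>R fst (a i))" "\<bar>S\<bar> + 1 \<le> (\<Sum>i\<in>{1..m}. snd (a i) * \<nu>' i)"
    by blast
  define \<mu> where "\<mu> i = 1 + \<bar>\<nu> i\<bar> + \<bar>\<nu>' i\<bar>" for i
  have "(\<Sum>i\<in>{1..m}. \<mu> i *\<^sub>R fst (a i)) = (\<Sum>i\<in>{1..m}. fst (a i)) + (\<Sum>i\<in>{1..m}. \<nu> i *\<^sub>R fst (a i))
      + (\<Sum>i\<in>{1..m}. \<nu>' i *\<^sub>R fst (a i))"
    using \<nu>(1) \<nu>'(1) by (simp add: \<mu>_def scaleR_add_left sum.distrib)
  also have "\<dots> = 0" unfolding \<nu>(2)[symmetric] \<nu>'(2)[symmetric] by simp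
  finally have \<mu>0: "(\<Sum>i\<in>{1..m}. \<mu> i *\<^sub>R fst (a i)) = 0" .
  have "(\<Sum>i\<in>{1..m}. \<mu> i * snd (a i)) = S + (\<Sum>i\<in>{1..m}. snd (a i) * \<nu>' i)"
    using \<nu>'(1) by (simp add: S_def \<mu>_def algebra_simps sum.distrib)
  then have \<mu>s: "1 \<le> (\<Sum>i\<in>{1..m}. \<mu> i * snd (a i))" using \<nu>'(3) by linarith
  have "\<exists>\<theta>0 D \<rho>. \<forall>\<theta>\<ge>\<theta>0. \<exists>\<Lambda>\<ge>0. \<forall>\<^sub>F \<epsilon> in at_right 0. \<forall>x\<in>cball xo \<epsilon>.
    \<exists>p\<in>cball 0 \<rho>. \<exists>c. c = (\<lambda>i. \<epsilon> * (\<theta> * \<mu> i + N i p)) \<and> small_controls (\<epsilon> * \<Lambda>) c \<and>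
    fst (u (steer \<psi> k c m x), w (steer \<psi> k c m x)) = fst (u xo, w xo) \<and>
    norm ((u (steer \<psi> k c m x), w (steer \<psi> k c m x)) - (u xo, w xo) - (\<Sum>i\<in>{1..m}. c i *\<^sub>R a i)) \<le> D * \<epsilon>"
    by (rule steer_onto[OF bounded_linear_fst v _ \<mu>0 N]) (simp add: \<mu>_def)
  then obtain \<theta>0 D \<rho> where onto: "\<And>\<theta>. \<theta> \<ge> \<theta>0 \<Longrightarrow> \<exists>\<Lambda>\<ge>0. \<forall>\<^sub>F \<epsilon> in at_right 0. \<forall>x\<in>cball xo \<epsilon>.
    \<exists>p\<in>cball 0 \<rho>. \<exists>c. c = (\<lambda>i. \<epsilon> * (\<theta> * \<mu> i + N i p)) \<and> small_controls (\<epsilon> * \<Lambda>) c \<and>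
    fst (u (steer \<psi> k c m x), w (steer \<psi> k c m x)) = fst (u xo, w xo) \<and>
    norm ((u (steer \<psi> k c m x), w (steer \<psi> k c m x)) - (u xo, w xo) - (\<Sum>i\<in>{1..m}. c i *\<^sub>R a i)) \<le> D * \<epsilon>"
    by blast
  define g where "g p = (\<Sum>i\<in>{1..m}. N i p * snd (a i))" for p
  have "bounded_linear g"
    unfolding g_def by (intro bounded_linear_sum bounded_linear_mult_const N(1))
  then obtain G where G: "G > 0" "\<And>p. norm (g p) \<le> norm p * G"
    using bounded_linear.pos_bounded by blast
  define \<theta> where "\<theta> = max \<theta>0 (\<bar>D\<bar> + \<bar>\<rho>\<bar> * G)"
  have \<theta>: "\<theta> \<ge> \<theta>0" "\<theta> \<ge> D + \<bar>\<rho>\<bar> * G" "\<theta> \<ge> 0"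
    using G(1) by (auto simp: \<theta>_def le_max_iff_disj)
  from onto[OF \<theta>(1)]
  obtain \<Lambda> where \<Lambda>: "\<Lambda> \<ge> 0" "\<forall>\<^sub>F \<epsilon> in at_right 0. \<forall>x\<in>cball xo \<epsilon>.
    \<exists>p\<in>cball 0 \<rho>. \<exists>c. c = (\<lambda>i. \<epsilon> * (\<theta> * \<mu> i + N i p)) \<and> small_controls (\<epsilon> * \<Lambda>) c \<and>
    fst (u (steer \<psi> k c m x), w (steer \<psi> k c m x)) = fst (u xo, w xo) \<and>
    norm ((u (steer \<psi> k c m x), w (steer \<psi> k c m x)) - (u xo, w xo) - (\<Sum>i\<in>{1..m}. c i *\<^sub>R a i)) \<le> D * \<epsilon>"
    by blast
  have "\<forall>\<^sub>F \<epsilon> in at_right 0. \<forall>x\<in>cball xo \<epsilon>. \<exists>c. small_controls (\<epsilon> * \<Lambda>) c \<and> steer \<psi> k c m x \<in> \<T>"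
    using \<Lambda>(2) steer_stays_near[OF \<Lambda>(1) \<open>0 < R\<close>] eventually_at_right_less[of "0::real"]
  proof eventually_elim
    case (elim \<epsilon>)
    show ?case
    proof
      fix x assume x: "x \<in> cball xo \<epsilon>"
      from elim(1)[rule_format, OF x]
      obtain p c where p: "p \<in> cball 0 \<rho>" and cp: "c = (\<lambda>i. \<epsilon> * (\<theta> * \<mu> i + N i p))"
        and c: "small_controls (\<epsilon> * \<Lambda>) c" "u (steer \<psi> k c m x) = u xo"
        "norm ((u (steer \<psi> k c m x), w (steer \<psi> k c m x)) - (u xo, w xo) - (\<Sum>i\<in>{1..m}. c i *\<^sub>R a i)) \<le> D * \<epsilon>"
        unfolding fst_conv by blast
      let ?z = "steer \<psi> k c m x"
      have "snd (\<Sum>i\<in>{1..m}. c i *\<^sub>R a i) = \<epsilon> * (\<theta> * (\<Sum>i\<in>{1..m}. \<mu> i * snd (a i)) + g p)"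
        by (simp add: snd_sum cp g_def sum_distrib_left sum.distrib[symmetric] algebra_simps)
      moreover have "\<bar>w ?z - w xo - snd (\<Sum>i\<in>{1..m}. c i *\<^sub>R a i)\<bar> \<le> D * \<epsilon>"
      proof -
        define q where "q = (u ?z, w ?z) - (u xo, w xo) - (\<Sum>i\<in>{1..m}. c i *\<^sub>R a i)"
        have "norm (snd q) \<le> D * \<epsilon>"
          using norm_snd_le[of "snd q" "fst q"] c(3) unfolding q_def[symmetric] by simp
        then show ?thesis by (simp add: q_def)
      qed
      moreover have "\<epsilon> * D \<le> \<epsilon> * (\<theta> * (\<Sum>i\<in>{1..m}. \<mu> i * snd (a i)) + g p)"
      proof -
        have "\<bar>g p\<bar> \<le> norm p * G" using G(2)[of p] by simp
        also have "\<dots> \<le> \<bar>\<rho>\<bar> * G" using p G(1) by (intro mult_right_mono) auto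
        finally have "D \<le> \<theta> * 1 + g p" using \<theta>(2) by linarith
        also have "\<dots> \<le> \<theta> * (\<Sum>i\<in>{1..m}. \<mu> i * snd (a i)) + g p"
          using \<mu>s \<theta>(3) by (intro add_right_mono mult_left_mono)
        finally show ?thesis using elim(3) by (intro mult_left_mono) auto
      qed
      ultimately have "w ?z \<ge> w xo" by (simp add: mult.commute abs_le_iff)
      then have "?z \<in> \<T> \<inter> cball xo R"
        unfolding \<T> using elim(2) x c by blast
      then show "\<exists>c. small_controls (\<epsilon> * \<Lambda>) c \<and> steer \<psi> k c m x \<in> \<T>" using c by blast
    qed
  qed
  then show ?thesis
    using \<Lambda>(1) unfolding small_controls_def by blast
qed

lemma order_le_max_order: "i \<in> {1..m} \<Longrightarrow> k i \<le> max_order m k"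
  by (simp add: max_order_def)

lemma cond_B1_smooth:
  assumes "cond_B1 A F m fs k v xo"
  shows "continuous_on UNIV v" "v differentiable at x"
proof -
  have v: "C_k (max_order m k) v" "0 < k 1" "1 \<in> {1..m}"
    using assms by (auto simp: cond_B1_def)
  then show "continuous_on UNIV v" "v differentiable at x"
    using C_k_continuous C_k_differentiable[OF v(1)] order_le_max_order[OF v(3), of k] by auto
qed

text \<open>The displacement bound is the expansion of the identity function.\<close>

lemma steering_multi_flow:
  fixes v :: "'a::euclidean_space \<Rightarrow> 'b::euclidean_space"
  assumes sys: "control_system A F" and lip: "lipschitz_in_state_on (cball xo R) A F L" "0 < R" "0 < L"
    and B1: "cond_B1 A F m fs k v xo" and id: "cond_identity m fs k xo"
  shows "steering xo v m k (\<lambda>i. multi_flow (fs i)) (leading_coeff fs k v xo)"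
proof
  fix i assume i: "i \<in> {1..m}"
  show k: "0 < k i" using B1 i by (simp add: cond_B1_def)
  have f: "has_flow_near xo f \<and> C_k (k i - 1) f" if "f \<in> set (fs i)" for f
    using B1 i that available_has_flow_near[OF sys _ lip] by (auto simp: cond_B1_def)
  have v: "C_k (k i) v"
    using B1 C_k_le order_le_max_order[OF i] by (auto simp: cond_B1_def)
  show "\<forall>\<^sub>F (t, x) in start xo. norm (v (multi_flow (fs i) t x) - v x - t ^ k i *\<^sub>R leading_coeff fs k v xo i)
      \<le> \<eta> * (t ^ k i + norm (x - xo))" if "0 < \<eta>" for \<eta>
    by (rule multi_flow_expansion[OF f v k _ _ that])
      (use B1 i in \<open>auto simp: cond_B1_def leading_coeff_def\<close>)
  define c where "c = (1 / fact (k i)) *\<^sub>R lie_boxplus (fs i) (k i) (\<lambda>x. x) xo"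
  have "\<forall>\<^sub>F (t, x) in start xo. norm (multi_flow (fs i) t x - x - t ^ k i *\<^sub>R c)
      \<le> 1 * (t ^ k i + norm (x - xo))"
    by (rule multi_flow_expansion[OF f C_k_ident k _ c_def zero_less_one])
      (use id i in \<open>auto simp: cond_identity_def\<close>)
  then have "\<forall>\<^sub>F (t, x) in start xo. norm (multi_flow (fs i) t x - x) \<le> (1 + norm c) * (t ^ k i + norm (x - xo))"
    using eventually_start_fst[OF zero_less_one, of xo]
  proof eventually_elim
    case (elim p)
    obtain t x where p: "p = (t, x)" by (cases p)
    have t: "0 \<le> t" using elim by (simp add: p)
    have "norm (multi_flow (fs i) t x - x) \<le> (t ^ k i + norm (x - xo)) + norm (t ^ k i *\<^sub>R c)"
      using elim(1) norm_triangle_sub[of "multi_flow (fs i) t x - x" "t ^ k i *\<^sub>R c"] by (simp add: p)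
    also have "norm (t ^ k i *\<^sub>R c) \<le> norm c * (t ^ k i + norm (x - xo))"
      using t by (simp add: algebra_simps)
    finally show ?case by (simp add: p algebra_simps)
  qed
  then show "\<exists>K\<ge>0. \<forall>\<^sub>F (t, x) in start xo. norm (multi_flow (fs i) t x - x) \<le> K * (t ^ k i + norm (x - xo))"
    by (intro exI[of _ "1 + norm c"]) auto
  show "\<exists>\<rho>>0. continuous_on ({0..\<rho>} \<times> cball xo \<rho>) (\<lambda>(t, x). multi_flow (fs i) t x)"
    using multi_flow_continuous f by blast
qed

lemma min_time_steer:
  assumes sys: "control_system A F"
    and "\<And>i f. i \<in> {1..n} \<Longrightarrow> f \<in> set (fs i) \<Longrightarrow> available A F f" "\<And>i. i \<in> {1..n} \<Longrightarrow> 0 \<le> c i"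
  shows "min_time A F \<T> x \<le> ereal (\<Sum>i\<in>{1..n}. real (length (fs i)) * root (k i) (c i))
    + min_time A F \<T> (steer (\<lambda>i. multi_flow (fs i)) k c n x)"
  using assms(2,3)
proof (induction n)
  case (Suc n)
  let ?\<psi> = "\<lambda>i. multi_flow (fs i)" and ?r = "root (k (Suc n)) (c (Suc n))"
  let ?S = "\<Sum>i\<in>{1..n}. real (length (fs i)) * root (k i) (c i)"
  have "0 \<le> ?r" using real_root_pos_pos_le Suc.prems(2)[of "Suc n"] by simp
  then have "min_time A F \<T> (steer ?\<psi> k c n x) \<le> ereal (real (length (fs (Suc n))) * ?r)
     + min_time A F \<T> (steer ?\<psi> k c (Suc n) x)"
    using min_time_multi_flow[OF sys, of "fs (Suc n)" ?r \<T> "steer ?\<psi> k c n x"] Suc.prems(1)[of "Suc n"] by auto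
  moreover have "min_time A F \<T> x \<le> ereal ?S + min_time A F \<T> (steer ?\<psi> k c n x)"
  proof (rule Suc.IH)
    show "available A F f" if "i \<in> {1..n}" "f \<in> set (fs i)" for i f
      using Suc.prems(1)[of i f] that by simp
    show "0 \<le> c i" if "i \<in> {1..n}" for i
      using Suc.prems(2)[of i] that by simp
  qed
  ultimately have "min_time A F \<T> x \<le> ereal ?S + (ereal (real (length (fs (Suc n))) * ?r)
     + min_time A F \<T> (steer ?\<psi> k c (Suc n) x))"
    by (meson add_left_mono order_trans)
  then show ?case by (simp flip: add.assoc)
qed simp

lemma attainability_steer_reaches_target:
  assumes sys: "control_system A F" and hyps: "attainability_hyps A F \<T> xo R L u w m fs k"
  shows "\<exists>\<Lambda>\<ge>0. \<forall>\<^sub>F \<epsilon> in at_right 0. \<forall>x\<in>cball xo \<epsilon>.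
    \<exists>c. (\<forall>i\<in>{1..m}. 0 \<le> c i \<and> c i \<le> \<epsilon> * \<Lambda>) \<and> steer (\<lambda>i. multi_flow (fs i)) k c m x \<in> \<T>"
proof -
  have R: "0 < R" "0 < L" and lip: "lipschitz_in_state_on (cball xo R) A F L"
    and id: "cond_identity m fs k xo"
    and cases: "target_I \<T> xo R u \<and> cond_B1 A F m fs k u xo \<and> positive_basis m (leading_coeff fs k u xo) \<or>
      target_II \<T> xo R u w \<and> cond_B1 A F m fs k (\<lambda>x. (u x, w x)) xo \<and>
        cond_B2_II m (leading_coeff fs k (\<lambda>x. (u x, w x)) xo)"
    using hyps by (simp_all add: attainability_hyps_def)
  from cases show ?thesis
  proof (elim disjE conjE)
    assume T: "target_I \<T> xo R u" and B1: "cond_B1 A F m fs k u xo"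
      and B2: "positive_basis m (leading_coeff fs k u xo)"
    have "\<T> \<inter> cball xo R = {x \<in> cball xo R. u x = u xo}"
      using T by (simp add: target_I_def)
    from steer_reaches_level_set[OF steering_multi_flow[OF sys lip R B1 id] cond_B1_smooth[OF B1] R(1) this B2]
    show ?thesis .
  next
    assume T: "target_II \<T> xo R u w" and B1: "cond_B1 A F m fs k (\<lambda>x. (u x, w x)) xo"
      and B2: "cond_B2_II m (leading_coeff fs k (\<lambda>x. (u x, w x)) xo)"
    have "\<T> \<inter> cball xo R = {x \<in> cball xo R. u x = u xo \<and> w x \<ge> w xo}"
      using T by (simp add: target_II_def)
    from steer_reaches_half_level_set[OF steering_multi_flow[OF sys lip R B1 id] cond_B1_smooth[OF B1] R(1) this B2]
    show ?thesis .
  qed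
qed

section \<open>Estimates of the minimum time\<close>

lemma root_scaled_le_powr:
  assumes "0 < \<kappa>" "\<kappa> \<le> \<kappa>'" "0 < \<epsilon>" "\<epsilon> \<le> 1" "0 \<le> c" "c \<le> \<epsilon> * \<Lambda>"
  shows "root \<kappa> c \<le> root \<kappa> \<Lambda> * \<epsilon> powr (1 / real \<kappa>')"
proof -
  have \<Lambda>: "0 \<le> \<Lambda>" using order_trans[OF assms(5,6)] assms(3) by (simp add: zero_le_mult_iff)
  have "root \<kappa> c \<le> root \<kappa> \<Lambda> * root \<kappa> \<epsilon>"
    using assms by (simp add: mult.commute flip: real_root_mult)
  also have "root \<kappa> \<epsilon> = \<epsilon> powr (1 / real \<kappa>)"
    using assms by (simp add: root_powr_inverse)
  also have "root \<kappa> \<Lambda> * \<epsilon> powr (1 / real \<kappa>) \<le> root \<kappa> \<Lambda> * \<epsilon> powr (1 / real \<kappa>')"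
    using assms \<Lambda> by (intro mult_left_mono powr_mono') (auto simp: field_simps real_root_pos_pos_le)
  finally show ?thesis .
qed

lemma attainability_imp_B1:
  assumes "attainability_hyps A F \<T> xo R L u w m fs k"
  shows "0 < m" "\<And>i. i \<in> {1..m} \<Longrightarrow> 0 < k i \<and> fs i \<noteq> [] \<and> (\<forall>f\<in>set (fs i). available A F f)"
    "0 < max_order m k"
proof -
  show 1: "0 < m" "\<And>i. i \<in> {1..m} \<Longrightarrow> 0 < k i \<and> fs i \<noteq> [] \<and> (\<forall>f\<in>set (fs i). available A F f)"
    using assms by (auto simp: attainability_hyps_def cond_B1_def)
  then have "1 \<in> {1..m}" by simp
  then show "0 < max_order m k"
    using 1(2)[of 1] order_le_max_order[of 1 m k] by linarith
qed

text \<open>With \<open>\<epsilon> = |x - xo|\<close> the target is reached, and group \<open>i\<close> takes the time \<open>O(\<epsilon>\<^bsup>1/k\<^sub>i\<^esup>)\<close>, which is at most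
  of the order given by the largest \<open>k\<^sub>i\<close>, since \<open>\<epsilon> \<le> 1\<close>.\<close>

lemma attainability_min_time_holder_at:
  assumes sys: "control_system A F" and "xo \<in> \<T>"
    and hyps: "attainability_hyps A F \<T> xo R L u w m fs k"
  shows "min_time A F \<T> xo = 0" "\<exists>C>0. \<exists>\<delta>>0. min_time_holder_at A F \<T> (max_order m k) C \<delta> xo"
proof -
  note B1 = attainability_imp_B1[OF hyps]
  have "1 \<in> {1..m}" using B1(1) by simp
  then obtain f where "f \<in> set (fs 1)" "available A F f"
    using B1(2)[of 1] list.set_sel(1) by blast
  then obtain a where "a \<in> A" by (auto simp: available_def)
  then show zero: "min_time A F \<T> xo = 0" using min_time_on_target[OF sys _ \<open>xo \<in> \<T>\<close>] by blast
  let ?\<kappa> = "max_order m k" and ?\<psi> = "\<lambda>i. multi_flow (fs i)"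
  obtain \<Lambda> where \<Lambda>: "\<Lambda> \<ge> 0" and ev: "\<forall>\<^sub>F \<epsilon> in at_right 0. \<forall>x\<in>cball xo \<epsilon>.
    \<exists>c. (\<forall>i\<in>{1..m}. 0 \<le> c i \<and> c i \<le> \<epsilon> * \<Lambda>) \<and> steer ?\<psi> k c m x \<in> \<T>"
    using attainability_steer_reaches_target[OF sys hyps] by blast
  obtain d where d: "0 < d" "\<And>\<epsilon> x. 0 < \<epsilon> \<Longrightarrow> \<epsilon> < d \<Longrightarrow> x \<in> cball xo \<epsilon> \<Longrightarrow>
    \<exists>c. (\<forall>i\<in>{1..m}. 0 \<le> c i \<and> c i \<le> \<epsilon> * \<Lambda>) \<and> steer ?\<psi> k c m x \<in> \<T>"
    using ev unfolding eventually_at_right[OF zero_less_one] by blast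
  define C where "C = (\<Sum>i\<in>{1..m}. real (length (fs i)) * root (k i) \<Lambda>) + 1"
  have S: "0 \<le> (\<Sum>i\<in>{1..m}. real (length (fs i)) * root (k i) \<Lambda>)"
    using \<Lambda> by (intro sum_nonneg mult_nonneg_nonneg real_root_pos_pos_le) auto
  have "min_time A F \<T> x \<le> ereal (C * norm (x - xo) powr (1 / real ?\<kappa>))"
    if x: "x \<in> cball xo (min 1 (d / 2))" for x
  proof (cases "x = xo")
    case False
    define \<epsilon> where "\<epsilon> = norm (x - xo)"
    have \<epsilon>: "0 < \<epsilon>" "\<epsilon> \<le> 1" "\<epsilon> < d" "x \<in> cball xo \<epsilon>"
      using x d(1) False by (auto simp: \<epsilon>_def dist_norm norm_minus_commute)
    obtain c where c: "\<And>i. i \<in> {1..m} \<Longrightarrow> 0 \<le> c i \<and> c i \<le> \<epsilon> * \<Lambda>" "steer ?\<psi> k c m x \<in> \<T>"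
      using d(2)[OF \<epsilon>(1,3,4)] by blast
    have "min_time A F \<T> x \<le> ereal (\<Sum>i\<in>{1..m}. real (length (fs i)) * root (k i) (c i))
        + min_time A F \<T> (steer ?\<psi> k c m x)"
      using B1(2) c(1) by (intro min_time_steer[OF sys]) auto
    also have "min_time A F \<T> (steer ?\<psi> k c m x) = 0"
      using min_time_on_target[OF sys \<open>a \<in> A\<close> c(2)] .
    also have "ereal (\<Sum>i\<in>{1..m}. real (length (fs i)) * root (k i) (c i)) + 0 \<le>
        ereal (\<Sum>i\<in>{1..m}. real (length (fs i)) * (root (k i) \<Lambda> * \<epsilon> powr (1 / real ?\<kappa>)))"
      using B1(2) order_le_max_order \<epsilon> c(1)
      by (auto intro!: sum_mono mult_left_mono root_scaled_le_powr)
    also have "\<dots> \<le> ereal (C * \<epsilon> powr (1 / real ?\<kappa>))"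
      by (simp add: C_def distrib_right sum_distrib_right mult.assoc)
    finally show ?thesis by (simp add: \<epsilon>_def)
  qed (simp add: zero)
  then show "\<exists>C>0. \<exists>\<delta>>0. min_time_holder_at A F \<T> ?\<kappa> C \<delta> xo"
    unfolding min_time_holder_at_def using d(1) S
    by (intro exI[of _ C] conjI exI[of _ "min 1 (d / 2)"]) (auto simp: C_def)
qed

lemma min_time_holder_at_imp_STLA:
  assumes zero: "min_time A F \<T> xo = 0" and "0 < \<kappa>" "0 < \<delta>" and hold: "min_time_holder_at A F \<T> \<kappa> C \<delta> xo"
  shows "STLA A F \<T> xo"
proof -
  have "((\<lambda>x. norm (x - xo)) \<longlongrightarrow> norm (xo - xo)) (at xo)"
    by (intro tendsto_intros)
  then have "((\<lambda>x. norm (x - xo) powr (1 / real \<kappa>)) \<longlongrightarrow> 0) (at xo)"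
    using \<open>0 < \<kappa>\<close> by (intro tendsto_zero_powrI[where b="1 / real \<kappa>"]) auto
  then have "((\<lambda>x. ereal (C * norm (x - xo) powr (1 / real \<kappa>))) \<longlongrightarrow> ereal (C * 0)) (at xo)"
    by (intro tendsto_intros)
  moreover have "\<forall>\<^sub>F x in at xo. min_time A F \<T> x \<le> ereal (C * norm (x - xo) powr (1 / real \<kappa>))"
    unfolding eventually_at
  proof (intro exI[of _ \<delta>] conjI ballI impI)
    fix x assume "x \<noteq> xo \<and> dist x xo < \<delta>"
    then have "x \<in> cball xo \<delta>" by (simp add: dist_commute)
    then show "min_time A F \<T> x \<le> ereal (C * norm (x - xo) powr (1 / real \<kappa>))"
      using hold unfolding min_time_holder_at_def by blast
  qed fact
  moreover have "\<forall>\<^sub>F x in at xo. ereal 0 \<le> min_time A F \<T> x"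
    using min_time_nonneg[of A F \<T>] unfolding zero_ereal_def by simp
  ultimately have "(min_time A F \<T> \<longlongrightarrow> ereal 0) (at xo)"
    using tendsto_sandwich[of "\<lambda>_. ereal 0" "min_time A F \<T>" "at xo"
        "\<lambda>x. ereal (C * norm (x - xo) powr (1 / real \<kappa>))" "ereal 0"] by simp
  then show ?thesis by (simp add: STLA_def isCont_def zero zero_ereal_def)
qed

lemma min_time_holder_near_imp_infdist:
  assumes "closed \<T>" "xo \<in> \<T>" "0 < \<delta>" and near: "min_time_holder_near A F \<T> \<kappa> C \<delta> xo"
  shows "\<forall>\<^sub>F x in nhds xo. min_time A F \<T> x \<le> ereal (C * infdist x \<T> powr (1 / real \<kappa>))"
  unfolding eventually_nhds_metric
proof (intro exI[of _ "\<delta> / 2"] conjI allI impI)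
  fix x assume x: "dist x xo < \<delta> / 2"
  obtain z where z: "z \<in> \<T>" "infdist x \<T> = dist x z"
    using infdist_attains_inf[OF assms(1)] assms(2) by blast
  have "dist x z \<le> dist x xo" using infdist_le[OF assms(2), of x] z by simp
  then have "x \<in> cball z \<delta>" "z \<in> cball xo \<delta> \<inter> \<T>"
    using x z(1) \<open>0 < \<delta>\<close> dist_triangle[of xo z x] by (auto simp: dist_commute)
  then have "min_time A F \<T> x \<le> ereal (C * norm (x - z) powr (1 / real \<kappa>))"
    using near unfolding min_time_holder_near_def min_time_holder_at_def by blast
  then show "min_time A F \<T> x \<le> ereal (C * infdist x \<T> powr (1 / real \<kappa>))"
    using z(2) by (simp add: dist_norm)
qed (use assms in auto)

text \<open>Compactness of a bounded part of the target makes the local constants uniform; on distances at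
  most \<open>1\<close> the exponents \<open>1 / j\<close> can be lowered to \<open>1 / \<kappa>\<close>.\<close>

lemma min_time_holder_uniform:
  assumes "closed \<T>" "bounded K"
    and near: "\<And>z. z \<in> \<T> \<Longrightarrow> \<exists>j C \<delta>. 0 < j \<and> j \<le> \<kappa> \<and> 0 < C \<and> 0 < \<delta> \<and> min_time_holder_near A F \<T> j C \<delta> z"
  obtains C \<delta> where "0 < C" "0 < \<delta>" "\<delta> \<le> 1"
    "\<And>z x. z \<in> \<T> \<inter> K \<Longrightarrow> x \<in> cball z \<delta> \<Longrightarrow> min_time A F \<T> x \<le> ereal (C * norm (x - z) powr (1 / real \<kappa>))"
proof -
  obtain j C \<delta> where *: "\<And>z. z \<in> \<T> \<Longrightarrow> 0 < j z \<and> j z \<le> \<kappa> \<and> 0 < C z \<and> 0 < \<delta> z \<and>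
      min_time_holder_near A F \<T> (j z) (C z) (\<delta> z) z"
    using near by metis
  have "compact (\<T> \<inter> closure K)"
    using assms(1,2) by (intro closed_Int_compact) (auto simp: compact_closure)
  moreover have "\<T> \<inter> closure K \<subseteq> (\<Union>z\<in>\<T> \<inter> closure K. ball z (\<delta> z))"
    using * by fastforce
  ultimately obtain Z where Z: "Z \<subseteq> \<T> \<inter> closure K" "finite Z" "\<T> \<inter> closure K \<subseteq> (\<Union>z\<in>Z. ball z (\<delta> z))"
    using compactE_image[of "\<T> \<inter> closure K" "\<T> \<inter> closure K" "\<lambda>z. ball z (\<delta> z)"] by (metis open_ball)
  define C' where "C' = Max (insert 1 (C ` Z))"
  define \<delta>' where "\<delta>' = Min (insert 1 (\<delta> ` Z))"
  have b: "C' \<ge> 1" "\<delta>' \<le> 1" "0 < \<delta>'" "\<And>z. z \<in> Z \<Longrightarrow> C z \<le> C'" "\<And>z. z \<in> Z \<Longrightarrow> \<delta>' \<le> \<delta> z"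
    using Z * by (auto simp: C'_def \<delta>'_def)
  show ?thesis
  proof (rule that)
    fix z x assume z: "z \<in> \<T> \<inter> K" and x: "x \<in> cball z \<delta>'"
    have "z \<in> \<T> \<inter> closure K" using z closure_subset[of K] by blast
    then obtain q where q: "q \<in> Z" "z \<in> ball q (\<delta> q)"
      using Z(3) by blast
    have j: "0 < j q" "j q \<le> \<kappa>" "min_time_holder_near A F \<T> (j q) (C q) (\<delta> q) q" "0 < C q"
      using * q Z(1) by auto
    have "x \<in> cball z (\<delta> q)" using x b(5)[OF q(1)] by auto
    then have "min_time A F \<T> x \<le> ereal (C q * norm (x - z) powr (1 / real (j q)))"
      using j(3) z q unfolding min_time_holder_near_def min_time_holder_at_def by auto
    also have "\<dots> \<le> ereal (C' * norm (x - z) powr (1 / real \<kappa>))"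
    proof -
      have "norm (x - z) \<le> 1" using x b(2) by (auto simp: dist_norm norm_minus_commute)
      then have "norm (x - z) powr (1 / real (j q)) \<le> norm (x - z) powr (1 / real \<kappa>)"
        using j by (intro powr_mono') (auto simp: field_simps)
      then show ?thesis
        using b(4)[OF q(1)] j(4) by (auto intro!: mult_mono)
    qed
    finally show "min_time A F \<T> x \<le> ereal (C' * norm (x - z) powr (1 / real \<kappa>))" .
  qed (use b in auto)
qed

text \<open>Near a point with finite minimum time, the minimum time is bounded: the control that works for this
  point, applied from nearby, ends near the target.  So all nearly optimal controls for nearby points
  have bounded duration and end in a bounded part of the target, where the estimate at target
  points is uniform.\<close>

lemma min_time_locally_holder:
  fixes F :: "'a::euclidean_space \<Rightarrow> 'c::metric_space \<Rightarrow> 'a"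
  assumes sys: "control_system A F" and "closed \<T>" and "0 < \<kappa>"
    and lip: "lipschitz_in_state_on UNIV A F L" "0 < L"
    and near: "\<And>z. z \<in> \<T> \<Longrightarrow> \<exists>j C \<delta>. 0 < j \<and> j \<le> \<kappa> \<and> 0 < C \<and> 0 < \<delta> \<and> min_time_holder_near A F \<T> j C \<delta> z"
  shows "locally_holder_on (1 / real \<kappa>) {x. min_time A F \<T> x < \<infinity>} (\<lambda>x. real_of_ereal (min_time A F \<T> x))"
  unfolding locally_holder_on_def
proof
  fix z assume "z \<in> {x. min_time A F \<T> x < \<infinity>}"
  then obtain \<alpha>0 y0 t0 where 0: "\<alpha>0 \<in> controls A" "trajectory F z \<alpha>0 y0" "0 \<le> t0" "y0 t0 \<in> \<T>"
    using min_time_lessE[of A F \<T> z \<infinity>] by blast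
  let ?T = "min_time A F \<T>"
  have ex: "\<exists>y. trajectory F x \<alpha> y" if "\<alpha> \<in> controls A" for x \<alpha>
    using control_system_trajectory_exists[OF sys that] .
  \<comment> \<open>the control reaching the target from the second point is applied from the first one\<close>
  have transfer: "?T x \<le> ereal t + ereal (C * (K * norm (x - x')) powr (1 / real \<kappa>))"
    if "\<alpha> \<in> controls A" "trajectory F x' \<alpha> y" "0 \<le> t" "y t \<in> \<T>" "0 \<le> C"
      and K: "\<And>y'. trajectory F x \<alpha> y' \<Longrightarrow> norm (y' t - y t) \<le> K * norm (x - x')"
      and \<delta>: "K * norm (x - x') \<le> \<delta>"
      and hold: "\<And>q. q \<in> cball (y t) \<delta> \<Longrightarrow> ?T q \<le> ereal (C * norm (q - y t) powr (1 / real \<kappa>))"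
    for x x' \<alpha> y t K C \<delta>
  proof -
    obtain y' where y': "trajectory F x \<alpha> y'" using ex \<open>\<alpha> \<in> controls A\<close> by blast
    have d: "norm (y' t - y t) \<le> K * norm (x - x')" using K[OF y'] .
    have "?T x \<le> ereal t + ?T (y' t)"
      using min_time_dynamic_programming that(1,3) y' by blast
    also have "?T (y' t) \<le> ereal (C * norm (y' t - y t) powr (1 / real \<kappa>))"
      using d \<delta> by (intro hold) (auto simp: dist_norm norm_minus_commute)
    also have "\<dots> \<le> ereal (C * (K * norm (x - x')) powr (1 / real \<kappa>))"
      using d \<open>0 \<le> C\<close> by (auto intro!: mult_left_mono powr_mono2)
    finally show ?thesis by (simp add: add_left_mono)
  qed
  obtain \<epsilon>1 \<tau> where \<epsilon>1: "\<epsilon>1 > 0" "\<epsilon>1 \<le> 1" "\<tau> \<ge> 0" "\<And>x. x \<in> cball z \<epsilon>1 \<Longrightarrow> ?T x < ereal \<tau>"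
  proof -
    obtain C \<delta> where C: "0 < C" "0 < \<delta>" "\<delta> \<le> 1" "\<And>q x. q \<in> \<T> \<inter> {y0 t0} \<Longrightarrow> x \<in> cball q \<delta> \<Longrightarrow>
        ?T x \<le> ereal (C * norm (x - q) powr (1 / real \<kappa>))"
      using min_time_holder_uniform[OF \<open>closed \<T>\<close> _ near, of "{y0 t0}"] by auto
    obtain K where K: "K \<ge> 1" "\<And>x x' \<alpha> y z t. trajectory F x \<alpha> y \<Longrightarrow> trajectory F x' \<alpha> z \<Longrightarrow>
        \<alpha> \<in> controls A \<Longrightarrow> t \<in> {0..t0} \<Longrightarrow> norm (y t - z t) \<le> K * norm (x - x')"
      using trajectory_dist[OF lip] by blast
    show ?thesis
    proof (rule that[of "min 1 (\<delta> / K)" "t0 + C + 1"])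
      fix x assume x: "x \<in> cball z (min 1 (\<delta> / K))"
      then have "norm (x - z) \<le> \<delta> / K" by (simp add: dist_norm norm_minus_commute)
      then have d: "K * norm (x - z) \<le> \<delta>" using K(1) by (simp add: field_simps)
      have "?T x \<le> ereal t0 + ereal (C * (K * norm (x - z)) powr (1 / real \<kappa>))"
        using 0 C d K(2)[OF _ 0(2)] by (intro transfer[OF 0, of C x K \<delta>]) auto
      also have "\<dots> < ereal (t0 + C + 1)"
      proof -
        have "(K * norm (x - z)) powr (1 / real \<kappa>) \<le> 1"
          using d C(3) K(1) \<open>0 < \<kappa>\<close> by (intro powr_le1) auto
        then have "C * (K * norm (x - z)) powr (1 / real \<kappa>) \<le> C * 1"
          using C(1) by (intro mult_left_mono) auto
        then show ?thesis by simp
      qed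
      finally show "?T x < ereal (t0 + C + 1)" .
    qed (use 0 C K in auto)
  qed
  obtain M where M: "\<And>x \<alpha> y t. x \<in> cball z \<epsilon>1 \<Longrightarrow> \<alpha> \<in> controls A \<Longrightarrow> trajectory F x \<alpha> y \<Longrightarrow>
      t \<in> {0..\<tau>} \<Longrightarrow> norm (y t) \<le> M"
  proof -
    have "\<forall>K \<tau>. bounded K \<longrightarrow>
        (\<exists>M. \<forall>x\<in>K. \<forall>\<alpha>\<in>controls A. \<forall>y. trajectory F x \<alpha> y \<longrightarrow> (\<forall>t\<in>{0..\<tau>}. norm (y t) \<le> M))"
      using sys unfolding control_system_def by blast
    from this[rule_format, OF bounded_cball, of z \<epsilon>1 \<tau>] that show ?thesis by blast
  qed
  obtain C \<delta> where C: "0 < C" "0 < \<delta>" "\<delta> \<le> 1" "\<And>q x. q \<in> \<T> \<inter> cball 0 M \<Longrightarrow> x \<in> cball q \<delta> \<Longrightarrow>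
      ?T x \<le> ereal (C * norm (x - q) powr (1 / real \<kappa>))"
    using min_time_holder_uniform[OF \<open>closed \<T>\<close> bounded_cball near, of 0 M] by metis
  obtain K where K: "K \<ge> 1" "\<And>x x' \<alpha> y z t. trajectory F x \<alpha> y \<Longrightarrow> trajectory F x' \<alpha> z \<Longrightarrow>
      \<alpha> \<in> controls A \<Longrightarrow> t \<in> {0..\<tau>} \<Longrightarrow> norm (y t - z t) \<le> K * norm (x - x')"
    using trajectory_dist[OF lip] by blast
  define \<epsilon> where "\<epsilon> = min \<epsilon>1 (\<delta> / (2 * K))"
  define C' where "C' = C * K powr (1 / real \<kappa>)"
  have fin: "?T x = ereal (real_of_ereal (?T x))" if "x \<in> cball z \<epsilon>" for x
  proof -
    have "?T x < ereal \<tau>" using \<epsilon>1(4)[of x] that by (simp add: \<epsilon>_def)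
    then show ?thesis using min_time_nonneg[of A F \<T> x] by (cases "?T x") auto
  qed
  have one: "real_of_ereal (?T x) \<le> real_of_ereal (?T x') + C' * dist x x' powr (1 / real \<kappa>)"
    if x: "x \<in> cball z \<epsilon>" and x': "x' \<in> cball z \<epsilon>" for x x'
  proof (rule field_le_epsilon)
    fix e :: real assume "e > 0"
    have "?T x' < ereal \<tau>" using \<epsilon>1(4)[of x'] x' by (simp add: \<epsilon>_def)
    moreover have "?T x' < ereal (real_of_ereal (?T x') + e)" using fin[OF x'] \<open>e > 0\<close>
      by (metis ereal_less(2) less_add_same_cancel1 less_ereal.simps(1))
    \<comment> \<open>the cap keeps the duration within the range of the uniform constants\<close>
    ultimately have "?T x' < min (ereal \<tau>) (ereal (real_of_ereal (?T x') + e))" by simp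
    then obtain \<alpha> y t where y: "\<alpha> \<in> controls A" "trajectory F x' \<alpha> y" "0 \<le> t" "y t \<in> \<T>"
      and t: "t \<le> \<tau>" "t \<le> real_of_ereal (?T x') + e"
      by (elim min_time_lessE) (auto intro: less_imp_le)
    have "norm (x - x') \<le> \<delta> / K"
    proof -
      have "dist x x' \<le> \<epsilon> + \<epsilon>" using x x' dist_triangle[of x x' z] by (auto simp: dist_commute)
      also have "\<dots> \<le> \<delta> / K" using K(1) by (simp add: \<epsilon>_def min_def field_simps)
      finally show ?thesis by (simp add: dist_norm)
    qed
    then have d: "K * norm (x - x') \<le> \<delta>" using K(1) by (simp add: field_simps)
    have "y t \<in> \<T> \<inter> cball 0 M"
      using M[of x' \<alpha> y t] x' y t by (auto simp: \<epsilon>_def)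
    note hold = C(4)[OF this]
    have "?T x \<le> ereal t + ereal (C * (K * norm (x - x')) powr (1 / real \<kappa>))"
      using C d K(2)[OF _ y(2) y(1)] t y(3) hold by (intro transfer[OF y, of C x K \<delta>]) auto
    also have "\<dots> = ereal (t + C' * dist x x' powr (1 / real \<kappa>))"
      using K(1) by (simp add: C'_def powr_mult dist_norm)
    finally have "ereal (real_of_ereal (?T x)) \<le> ereal (t + C' * dist x x' powr (1 / real \<kappa>))"
      using fin[OF x] by simp
    then show "real_of_ereal (?T x) \<le> real_of_ereal (?T x') + C' * dist x x' powr (1 / real \<kappa>) + e"
      using t(2) by simp
  qed
  have "dist (real_of_ereal (?T x)) (real_of_ereal (?T x')) \<le> C' * dist x x' powr (1 / real \<kappa>)"
    if "x \<in> cball z \<epsilon>" "x' \<in> cball z \<epsilon>" for x x'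
    using one[OF that] one[OF that(2,1)] by (simp add: dist_real_def dist_commute abs_le_iff)
  moreover have "\<epsilon> > 0" using \<epsilon>1 C K by (simp add: \<epsilon>_def)
  ultimately show "\<exists>\<epsilon>>0. \<exists>C. \<forall>x\<in>cball z \<epsilon> \<inter> {x. ?T x < \<infinity>}. \<forall>y\<in>cball z \<epsilon> \<inter> {x. ?T x < \<infinity>}.
      dist (real_of_ereal (?T x)) (real_of_ereal (?T y)) \<le> C * dist x y powr (1 / real \<kappa>)"
    by blast
qed

theorem theorem4p7:
  fixes A :: "'c::metric_space set"
    and F :: "real^'n \<Rightarrow> 'c \<Rightarrow> real^'n"
    and \<T> :: "(real^'n) set"
    and xo :: "real^'n"
    and u :: "real^'n \<Rightarrow> real^'h"
    and w :: "real^'n \<Rightarrow> real"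
    and R L :: real
    and m :: nat
    and fs :: "nat \<Rightarrow> (real^'n \<Rightarrow> real^'n) list"
    and k :: "nat \<Rightarrow> nat"
  assumes "CARD('h) \<le> CARD('n) - 1"
    and "control_system A F"
    and "closed \<T>"
    and "xo \<in> \<T>"
    and "attainability_hyps A F \<T> xo R L u w m fs k"
  shows "STLA A F \<T> xo \<and>
    (\<exists>C>0. \<exists>\<delta>>0. min_time_holder_at A F \<T> (max_order m k) C \<delta> xo) \<and>
    (\<forall>C>0. \<forall>\<delta>>0. min_time_holder_near A F \<T> (max_order m k) C \<delta> xo \<longrightarrow>
           (\<forall>\<^sub>F x in nhds xo.
              min_time A F \<T> x \<le> ereal (C * infdist x \<T> powr (1 / real (max_order m k))))) \<and>
    (\<forall>\<kappa>. (\<forall>z\<in>\<T>. \<exists>R L (u :: real^'n \<Rightarrow> real^'h) w m fs k.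
                  attainability_hyps A F \<T> z R L u w m fs k \<and> max_order m k \<le> \<kappa> \<and>
                  (\<exists>C>0. \<exists>\<delta>>0. min_time_holder_near A F \<T> (max_order m k) C \<delta> z)) \<and>
               (\<exists>L>0. lipschitz_in_state_on UNIV A F L) \<longrightarrow>
           locally_holder_on (1 / real \<kappa>) {x. min_time A F \<T> x < \<infinity>}
             (\<lambda>x. real_of_ereal (min_time A F \<T> x)))"
proof (intro conjI allI impI)
  note hyps = assms(5)
  show holder: "\<exists>C>0. \<exists>\<delta>>0. min_time_holder_at A F \<T> (max_order m k) C \<delta> xo"
    by (rule attainability_min_time_holder_at(2)[OF assms(2,4) hyps])
  then show "STLA A F \<T> xo"
    using min_time_holder_at_imp_STLA attainability_min_time_holder_at(1)[OF assms(2,4) hyps]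
      attainability_imp_B1(3)[OF hyps] by blast
  show "\<forall>\<^sub>F x in nhds xo. min_time A F \<T> x \<le> ereal (C * infdist x \<T> powr (1 / real (max_order m k)))"
    if "0 < C" "0 < \<delta>" "min_time_holder_near A F \<T> (max_order m k) C \<delta> xo" for C \<delta>
    using min_time_holder_near_imp_infdist[OF assms(3,4) that(2,3)] .
next
  fix \<kappa>
  assume "(\<forall>z\<in>\<T>. \<exists>R L (u :: real^'n \<Rightarrow> real^'h) w m fs k.
                  attainability_hyps A F \<T> z R L u w m fs k \<and> max_order m k \<le> \<kappa> \<and>
                  (\<exists>C>0. \<exists>\<delta>>0. min_time_holder_near A F \<T> (max_order m k) C \<delta> z)) \<and>
               (\<exists>L>0. lipschitz_in_state_on UNIV A F L)"
  then obtain L' where L': "0 < L'" "lipschitz_in_state_on UNIV A F L'"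
    and all: "\<forall>z\<in>\<T>. \<exists>R L (u :: real^'n \<Rightarrow> real^'h) w m fs k.
                  attainability_hyps A F \<T> z R L u w m fs k \<and> max_order m k \<le> \<kappa> \<and>
                  (\<exists>C>0. \<exists>\<delta>>0. min_time_holder_near A F \<T> (max_order m k) C \<delta> z)"
    by blast
  have near: "\<exists>j C \<delta>. 0 < j \<and> j \<le> \<kappa> \<and> 0 < C \<and> 0 < \<delta> \<and> min_time_holder_near A F \<T> j C \<delta> z"
    if "z \<in> \<T>" for z
  proof -
    from all[rule_format, OF that] obtain R L C \<delta> and u :: "real^'n \<Rightarrow> real^'h" and w m fs k
      where z: "attainability_hyps A F \<T> z R L u w m fs k" and "max_order m k \<le> \<kappa>" "0 < C" "0 < \<delta>"
        "min_time_holder_near A F \<T> (max_order m k) C \<delta> z"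
      by blast
    then show ?thesis using attainability_imp_B1(3)[OF z] by blast
  qed
  from near[OF assms(4)] have "0 < \<kappa>" by auto
  then show "locally_holder_on (1 / real \<kappa>) {x. min_time A F \<T> x < \<infinity>}
             (\<lambda>x. real_of_ereal (min_time A F \<T> x))"
    using min_time_locally_holder[OF assms(2,3) _ L'(2,1) near] by blast
qed

end
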